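(* Let $f:\mathbb{C}\to\widehat{\mathbb{C}}$ be a meromorphic map of degree larger than $1$ and let $U$ be a simply connected invariant Baker domain of $f$, such that $f|_U$ is of hyperbolic or simply parabolic type (i.e. $\varrho_U(f^{n+1}(z),f^n(z))\not\to 0$ as $n\to\infty$ for $z\in U$). Suppose that the degree of $f$ on $U$ is finite. Then the set $\mathcal{I}(f)\cap\partial U$ of escaping points in the boundary of $U$ has full harmonic measure. More generally, the same conclusion holds if, instead of assuming that the degree of $f$ on $U$ is finite, one assumes that the associated inner function $g=\varphi^{-1}\circ f\circ\varphi$, where $\varphi:\mathbb{D}\to U$ is a Riemann map, has non-singular Denjoy--Wolff point.
   Context: $\mathbb{D}$ is the open unit disc and $\widehat{\mathbb{C}}$ the Riemann sphere; closures and boundaries are taken in $\mathbb{C}$. The Fatou set of $f$ is the set of points having a neighbourhood on which all iterates $f^n$ are defined and form a normal family; its connected components are the Fatou components. An invariant Baker domain is a Fatou component $U\subset\mathbb{C}$ with $f(U)\subset U$ such that $f^n\to\infty$ locally uniformly on $U$ as $n\to\infty$. The escaping set is $\mathcal{I}(f)=\{z\in\mathbb{C}: f^n(z)\text{ is defined for every }n\ge 0\text{ and }f^n(z)\to\infty\}$. The degree of $f$ on $U$ is the degree of the holomorphic map $f|_U:U\to U$. $\varrho_U$ denotes the hyperbolic distance in $U$, normalized so that $d\varrho_{\mathbb{D}}(z)=\frac{2|dz|}{1-|z|^2}$. Harmonic measure: for a Riemann map $\varphi:\mathbb{D}\to U$, radial limits of $\varphi$ exist at Lebesgue-almost every point of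 $\partial\mathbb{D}$, and the harmonic measure on $\partial U$ is the image of normalized Lebesgue measure on $\partial\mathbb{D}$ under this boundary map. Having full harmonic measure means that the complement in $\partial U$ has harmonic measure zero (this does not depend on the choice of $\varphi$). Associated inner function: $g=\varphi^{-1}\circ f\circ\varphi:\mathbb{D}\to\mathbb{D}$ is an inner function, i.e. a holomorphic self-map of $\mathbb{D}$ whose radial limits have modulus $1$ at almost every point of $\partial\mathbb{D}$. Since $U$ is a Baker domain, $g$ has no fixed point in $\mathbb{D}$, and by the Denjoy--Wolff theorem there is a point $p\in\partial\mathbb{D}$ (the Denjoy--Wolff point) with $g^n\to p$ locally uniformly on $\mathbb{D}$. A point $\zeta\in\partial\mathbb{D}$ is singular for $g$ if $g$ cannot be extended holomorphically to any neighbourhood of $\zeta$, and non-singular otherwise. Type: by Cowen's theorem, for a holomorphic $h:\mathbb{D}\to\mathbb{D}$ with Denjoy--Wolff point in $\partial\mathbb{D}$ there exist a simply connected domain $V\subset\mathbb{D}$, a domain $\Omega$ equal to $\mathbb{H}=\{\operatorname{Re}z>0\}$ or $\mathbb{C}$, a holomorphic map $\psi:\mathbb{D}\to\Omega$ and a Möbius transformation $T$ of $\Omega$ onto itself such that $V$ is absorbing in $\mathbb{D}$ for $h$ (i.e. $h(V)\subset V$ and for each compact $K\subset\mathbb{D}$ there is $n\ge0$ with $h^n(K)\subset V$), $\psi(V)$ is absorbing in $\Omega$ for $T$, $\psi\circ h=T\circ\psi$ on $\mathbb{D}$, and $\psi$ is univalent on $V$. Up to conjugation by a Möbius map preserving $\Omega$,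 exactly one of the following holds: $\Omega=\mathbb{H}$, $T(\omega)=a\omega$ with $a>1$ (hyperbolic type); $\Omega=\mathbb{H}$, $T(\omega)=\omega\pm i$ (simply parabolic type); $\Omega=\mathbb{C}$, $T(\omega)=\omega+1$ (doubly parabolic type). The type of $f|_U$ is the type of $g$. It is known that $f|_U$ is of doubly parabolic type if and only if $\varrho_U(f^{n+1}(z),f^n(z))\to0$ for some (equivalently every) $z\in U$. *)

theory Defs
  imports "HOL-Complex_Analysis.Complex_Analysis" "HOL-Probability.Probability_Measure"
begin

(* A meromorphic map from the plane to the Riemann sphere is given by a function
   f :: complex => complex with f nicely_meromorphic_on UNIV. Its value at a pole is
   infinity, while the function f itself takes the dummy value 0 there; hence iterates
   and preimages below always keep track of poles. The sphere is complex option, with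
   None as the point at infinity. *)

type_synonym riemann_sphere = "complex option"

definition sphere_map :: "(complex \<Rightarrow> complex) \<Rightarrow> complex \<Rightarrow> riemann_sphere" where
  "sphere_map f z = (if is_pole f z then None else Some (f z))"

fun chordal_dist :: "riemann_sphere \<Rightarrow> riemann_sphere \<Rightarrow> real" where
  "chordal_dist (Some z) (Some w) =
     2 * dist z w / (sqrt (1 + (norm z)\<^sup>2) * sqrt (1 + (norm w)\<^sup>2))"
| "chordal_dist (Some z) None = 2 / sqrt (1 + (norm z)\<^sup>2)"
| "chordal_dist None (Some w) = 2 / sqrt (1 + (norm w)\<^sup>2)"
| "chordal_dist None None = 0"


(* The degree is the supremum, over all points of the sphere, of the number of preimages
   counted with multiplicity. For a rational map of degree d and A = UNIV this is d:
   leaving out the preimage infinity affects only the value taken there. For a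
   transcendental map and A = UNIV it is infinite, by Picard's theorem. *)

definition local_degree :: "(complex \<Rightarrow> complex) \<Rightarrow> complex \<Rightarrow> nat" where
  "local_degree f z =
     (if is_pole f z then nat (- zorder f z) else nat (zorder (\<lambda>w. f w - f z) z))"

definition preimage_count :: "(complex \<Rightarrow> complex) \<Rightarrow> complex set \<Rightarrow> riemann_sphere \<Rightarrow> enat" where
  "preimage_count f A w =
     (let P = {z \<in> A. sphere_map f z = w}
      in if finite P then enat (\<Sum>z\<in>P. local_degree f z) else \<infinity>)"

definition map_degree :: "(complex \<Rightarrow> complex) \<Rightarrow> complex set \<Rightarrow> enat" where
  "map_degree f A = (if f constant_on A then 0 else (SUP w. preimage_count f A w))"


(* All iterates of f are defined at z, as elements of the plane, iff no point of the
   orbit is a pole. The function f ^^ n is the n-th iterate only under this condition. *)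

definition iterates_defined :: "(complex \<Rightarrow> complex) \<Rightarrow> complex \<Rightarrow> bool" where
  "iterates_defined f z \<longleftrightarrow> (\<forall>n. \<not> is_pole f ((f ^^ n) z))"

(* Normality in the spherical sense: limit functions may take the value infinity. *)
definition normal_family_on :: "complex set \<Rightarrow> (complex \<Rightarrow> complex) set \<Rightarrow> bool" where
  "normal_family_on N \<F> \<longleftrightarrow>
     (\<forall>s :: nat \<Rightarrow> complex \<Rightarrow> complex. range s \<subseteq> \<F> \<longrightarrow>
        (\<exists>r (l :: complex \<Rightarrow> riemann_sphere). strict_mono r \<and>
           (\<forall>K. compact K \<and> K \<subseteq> N \<longrightarrow>
              (\<forall>\<epsilon>>0. \<forall>\<^sub>F n in sequentially.
                 \<forall>z\<in>K. chordal_dist (Some (s (r n) z)) (l z) < \<epsilon>))))"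

definition fatou_set :: "(complex \<Rightarrow> complex) \<Rightarrow> complex set" where
  "fatou_set f = {z. \<exists>N. open N \<and> z \<in> N \<and> (\<forall>w\<in>N. iterates_defined f w) \<and>
                         normal_family_on N (range (\<lambda>n. f ^^ n))}"

definition invariant_Baker_domain :: "(complex \<Rightarrow> complex) \<Rightarrow> complex set \<Rightarrow> bool" where
  "invariant_Baker_domain f U \<longleftrightarrow>
     U \<in> components (fatou_set f) \<and> f ` U \<subseteq> U \<and>
     (\<forall>K. compact K \<and> K \<subseteq> U \<longrightarrow>
        (\<forall>B. \<forall>\<^sub>F n in sequentially. \<forall>z\<in>K. norm ((f ^^ n) z) > B))"

definition escaping_set :: "(complex \<Rightarrow> complex) \<Rightarrow> complex set" where
  "escaping_set f =
     {z. iterates_defined f z \<and> filterlim (\<lambda>n. (f ^^ n) z) at_infinity sequentially}"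


definition riemann_map :: "(complex \<Rightarrow> complex) \<Rightarrow> complex set \<Rightarrow> bool" where
  "riemann_map \<phi> U \<longleftrightarrow> \<phi> holomorphic_on ball 0 1 \<and> bij_betw \<phi> (ball 0 1) U"

definition associated_inner_function ::
  "(complex \<Rightarrow> complex) \<Rightarrow> (complex \<Rightarrow> complex) \<Rightarrow> complex \<Rightarrow> complex" where
  "associated_inner_function \<phi> f = inv_into (ball 0 1) \<phi> \<circ> f \<circ> \<phi>"

definition Denjoy_Wolff_point :: "(complex \<Rightarrow> complex) \<Rightarrow> complex \<Rightarrow> bool" where
  "Denjoy_Wolff_point g p \<longleftrightarrow> p \<in> sphere 0 1 \<and>
     (\<forall>K. compact K \<and> K \<subseteq> ball 0 1 \<longrightarrow>
        uniform_limit K (\<lambda>n. g ^^ n) (\<lambda>_. p) sequentially)"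

definition nonsingular_at :: "(complex \<Rightarrow> complex) \<Rightarrow> complex \<Rightarrow> bool" where
  "nonsingular_at g \<zeta> \<longleftrightarrow>
     (\<exists>N G. open N \<and> \<zeta> \<in> N \<and> G holomorphic_on N \<and> (\<forall>z \<in> N \<inter> ball 0 1. G z = g z))"


definition circle_measure :: "complex measure" where
  "circle_measure =
     distr (uniform_measure lborel {0..2*pi}) (restrict_space borel (sphere 0 1)) cis"

(* Where the radial limit does not exist in the plane, this is an arbitrary fixed value; for a Riemann
   map the set of such points is a null set. *)
definition radial_limit :: "(complex \<Rightarrow> complex) \<Rightarrow> complex \<Rightarrow> complex" where
  "radial_limit \<phi> \<zeta> = Lim (at_left 1) (\<lambda>r::real. \<phi> (of_real r * \<zeta>))"

definition harmonic_measure :: "(complex \<Rightarrow> complex) \<Rightarrow> complex measure" where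
  "harmonic_measure \<phi> = distr circle_measure borel (radial_limit \<phi>)"

lemma prob_space_circle_measure: "prob_space circle_measure"
proof -
  have "prob_space (uniform_measure lborel {0..2*pi})"
    by (rule prob_space_uniform_measure) simp_all
  moreover have "cis \<in> uniform_measure lborel {0..2*pi} \<rightarrow>\<^sub>M restrict_space borel (sphere 0 1)"
  proof (rule measurable_restrict_space2)
    have "cis \<in> borel_measurable borel"
      by (intro borel_measurable_continuous_onI continuous_intros)
    then show "cis \<in> borel_measurable (uniform_measure lborel {0..2*pi})"
      by (simp cong: measurable_cong_sets)
  qed auto
  ultimately show ?thesis
    unfolding circle_measure_def by (rule prob_space.prob_space_distr)
qed

lemma measurable_radial_limit:
  assumes "continuous_on (ball 0 1) \<phi>"
  shows "radial_limit \<phi> \<in> borel_measurable circle_measure"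
proof -
  define M :: "complex measure" where "M = restrict_space borel (sphere 0 1)"
  define A where "A k m = {\<zeta> \<in> sphere 0 1. \<forall>r\<in>{1 - 1 / real (Suc m)<..<1}. \<forall>s\<in>{1 - 1 / real (Suc m)<..<1}.
     dist (\<phi> (of_real r * \<zeta>)) (\<phi> (of_real s * \<zeta>)) \<le> 1 / real (Suc k)}" for k m
  define E where "E = (\<Inter>k. \<Union>m. A k m)"
  define u where "u n \<zeta> = \<phi> (of_real (1 - 1 / real (Suc (Suc n))) * \<zeta>)" for n \<zeta>
  have cont: "continuous_on (sphere 0 1) (\<lambda>\<zeta>. \<phi> (of_real r * \<zeta>))" if "0 \<le> r" "r < 1" for r
    by (rule continuous_on_compose2[OF assms]) (use that in \<open>auto intro!: continuous_intros simp: norm_mult\<close>)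
  have mpos: "0 \<le> r" if "r \<in> {1 - 1 / real (Suc m)<..<1}" for r m
  proof -
    have "1 / real (Suc m) \<le> 1" by simp
    then show ?thesis using that unfolding greaterThanLessThan_iff by linarith
  qed
  have closedA: "closed (A k m)" for k m
  proof -
    let ?B = "\<lambda>r s. {\<zeta> \<in> sphere 0 1. dist (\<phi> (of_real r * \<zeta>)) (\<phi> (of_real s * \<zeta>)) \<le> 1 / real (Suc k)}"
    let ?I = "{1 - 1 / real (Suc m)<..<1}"
    have "(1 - 1 / real (Suc m) + 1) / 2 \<in> ?I" by (auto simp: field_simps)
    then have ne: "?I \<noteq> {}" by blast
    have "closed (?B r s)" if "r \<in> ?I" "s \<in> ?I" for r s
    proof -
      have "continuous_on (sphere 0 1) (\<lambda>\<zeta>. dist (\<phi> (of_real r * \<zeta>)) (\<phi> (of_real s * \<zeta>)))"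
        by (intro continuous_on_dist cont) (use that mpos in auto)
      from continuous_closed_preimage[OF this closed_sphere, of "{..1 / real (Suc k)}"]
      show ?thesis by (simp add: vimage_def Int_def)
    qed
    then have "closed (\<Inter>r\<in>?I. \<Inter>s\<in>?I. ?B r s)" by (intro closed_INT ballI) auto
    moreover have "A k m = (\<Inter>r\<in>?I. \<Inter>s\<in>?I. ?B r s)"
      unfolding A_def using ne by blast
    ultimately show ?thesis by simp
  qed
  have E: "E \<in> sets M"
  proof -
    have "E \<in> sets borel" unfolding E_def using closedA by (intro sets.countable_INT) (auto intro!: sets.countable_UN)
    moreover have "E \<subseteq> sphere 0 1" unfolding E_def A_def by auto
    ultimately show ?thesis unfolding M_def by (auto simp: sets_restrict_space_iff)
  qed
  have umeas: "u n \<in> borel_measurable M" for n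
    unfolding u_def M_def by (intro borel_measurable_continuous_on_restrict cont) auto
  have seq: "filterlim (\<lambda>n. 1 - 1 / real (Suc (Suc n))) (at_left 1) sequentially"
    unfolding filterlim_at
  proof
    have "(\<lambda>n. 1 - inverse (real (Suc n))) \<longlonglongrightarrow> 1 - 0"
      by (intro tendsto_intros LIMSEQ_inverse_real_of_nat)
    from LIMSEQ_Suc[OF this]
    show "(\<lambda>n. 1 - 1 / real (Suc (Suc n))) \<longlonglongrightarrow> 1"
      by (simp add: inverse_eq_divide)
  qed auto
  have conv_iff: "(\<exists>l. ((\<lambda>r::real. \<phi> (of_real r * \<zeta>)) \<longlongrightarrow> l) (at_left 1)) \<longleftrightarrow> \<zeta> \<in> E"
    if z: "\<zeta> \<in> sphere 0 1" for \<zeta>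
  proof
    assume "\<exists>l. ((\<lambda>r::real. \<phi> (of_real r * \<zeta>)) \<longlongrightarrow> l) (at_left 1)"
    then obtain l where l: "((\<lambda>r::real. \<phi> (of_real r * \<zeta>)) \<longlongrightarrow> l) (at_left 1)" by blast
    have "\<exists>m. \<zeta> \<in> A k m" for k
    proof -
      have "eventually (\<lambda>r::real. dist (\<phi> (of_real r * \<zeta>)) l < 1 / real (Suc k) / 2) (at_left 1)"
        by (rule tendstoD[OF l]) simp
      then obtain b where b: "b < 1" "\<And>r. b < r \<Longrightarrow> r < 1 \<Longrightarrow> dist (\<phi> (of_real r * \<zeta>)) l < 1 / real (Suc k) / 2"
        unfolding eventually_at_left_field by blast
      obtain m where m: "1 / real (Suc m) < 1 - b"
        using nat_approx_posE[of "1 - b"] b(1) by auto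
      have "\<zeta> \<in> A k m" unfolding A_def
      proof (clarsimp simp: z[simplified] simp del: of_nat_Suc)
        fix r s :: real assume "1 - 1 / real (Suc m) < r" "r < 1" "1 - 1 / real (Suc m) < s" "s < 1"
        then have "dist (\<phi> (of_real r * \<zeta>)) l < 1 / real (Suc k) / 2" "dist (\<phi> (of_real s * \<zeta>)) l < 1 / real (Suc k) / 2"
          using b(2) m by (simp_all del: of_nat_Suc)
        then show "dist (\<phi> (of_real r * \<zeta>)) (\<phi> (of_real s * \<zeta>)) \<le> 1 / real (Suc k)"
          using dist_triangle_half_l[of "\<phi> (of_real r * \<zeta>)" l "1 / real (Suc k)" "\<phi> (of_real s * \<zeta>)"]
          by (simp del: of_nat_Suc)
      qed
      then show ?thesis by blast
    qed
    then show "\<zeta> \<in> E" unfolding E_def by auto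
  next
    assume zE: "\<zeta> \<in> E"
    let ?x = "\<lambda>r::real. \<phi> (of_real r * \<zeta>)"
    have ev: "\<exists>P. eventually P (at_left 1) \<and> (\<forall>r s. P r \<and> P s \<longrightarrow> dist (?x r) (?x s) < e)" if "e > 0" for e
    proof -
      obtain k where k: "1 / real (Suc k) < e" using nat_approx_posE[OF \<open>e > 0\<close>] by blast
      obtain m where m: "\<zeta> \<in> A k m" using zE unfolding E_def by blast
      have "eventually (\<lambda>r. r \<in> {1 - 1 / real (Suc m)<..<1}) (at_left 1)"
        by (rule eventually_at_left_real) simp
      moreover have "\<forall>r s. r \<in> {1 - 1 / real (Suc m)<..<1} \<and> s \<in> {1 - 1 / real (Suc m)<..<1} \<longrightarrow>
          dist (?x r) (?x s) < e"
        using m k unfolding A_def by fastforce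
      ultimately show ?thesis by blast
    qed
    have "cauchy_filter (filtermap ?x (at_left 1))"
      unfolding cauchy_filter_metric_filtermap using ev by blast
    moreover have "filtermap ?x (at_left 1) \<noteq> bot" by (simp add: filtermap_bot_iff trivial_limit_at_left_real)
    ultimately obtain l where "filtermap ?x (at_left 1) \<le> nhds l"
      using complete_UNIV unfolding complete_uniform by auto
    then show "\<exists>l. (?x \<longlongrightarrow> l) (at_left 1)" unfolding filterlim_def by blast
  qed
  have eq: "radial_limit \<phi> \<zeta> = (if \<zeta> \<in> E then lim (\<lambda>n. u n \<zeta>) else (THE l. False))"
    if z: "\<zeta> \<in> space M" for \<zeta>
  proof (cases "\<zeta> \<in> E")
    case True
    then obtain l where l: "((\<lambda>r::real. \<phi> (of_real r * \<zeta>)) \<longlongrightarrow> l) (at_left 1)"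
      using conv_iff z unfolding M_def by (auto simp: space_restrict_space)
    then have "radial_limit \<phi> \<zeta> = l"
      unfolding radial_limit_def by (intro tendsto_Lim) auto
    moreover have "(\<lambda>n. u n \<zeta>) \<longlonglongrightarrow> l"
      unfolding u_def using filterlim_compose[OF l seq] by simp
    ultimately show ?thesis using True by (simp add: limI)
  next
    case False
    then have "\<nexists>l. ((\<lambda>r::real. \<phi> (of_real r * \<zeta>)) \<longlongrightarrow> l) (at_left 1)"
      using conv_iff z unfolding M_def by (auto simp: space_restrict_space)
    then show ?thesis using False unfolding radial_limit_def Topological_Spaces.Lim_def by simp
  qed
  have "(\<lambda>\<zeta>. if \<zeta> \<in> E then lim (\<lambda>n. u n \<zeta>) else (THE l. False)) \<in> borel_measurable M"
    using E umeas by (intro measurable_If_set borel_measurable_lim_metric) auto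
  then have "radial_limit \<phi> \<in> borel_measurable M"
    by (subst measurable_cong[OF eq]) auto
  then show ?thesis
    unfolding circle_measure_def M_def by simp
qed

lemma prob_space_harmonic_measure:
  assumes "riemann_map \<phi> U"
  shows "prob_space (harmonic_measure \<phi>)"
  unfolding harmonic_measure_def
  using assms prob_space_circle_measure
  by (intro prob_space.prob_space_distr measurable_radial_limit)
     (auto simp: riemann_map_def holomorphic_on_imp_continuous_on)

definition full_harmonic_measure :: "complex set \<Rightarrow> complex set \<Rightarrow> bool" where
  "full_harmonic_measure U E \<longleftrightarrow>
     (\<forall>\<phi>. riemann_map \<phi> U \<longrightarrow> frontier U - E \<in> null_sets (completion (harmonic_measure \<phi>)))"


definition absorbing :: "(complex \<Rightarrow> complex) \<Rightarrow> complex set \<Rightarrow> complex set \<Rightarrow> bool" where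
  "absorbing h V S \<longleftrightarrow> V \<subseteq> S \<and> h ` V \<subseteq> V \<and>
     (\<forall>K. compact K \<and> K \<subseteq> S \<longrightarrow> (\<exists>n. (h ^^ n) ` K \<subseteq> V))"

definition Cowen_model ::
  "(complex \<Rightarrow> complex) \<Rightarrow> complex set \<Rightarrow> complex set \<Rightarrow> (complex \<Rightarrow> complex) \<Rightarrow>
   (complex \<Rightarrow> complex) \<Rightarrow> bool" where
  "Cowen_model h V \<Omega> \<psi> T \<longleftrightarrow>
     open V \<and> V \<noteq> {} \<and> simply_connected V \<and>
     \<psi> holomorphic_on ball 0 1 \<and> \<psi> ` ball 0 1 \<subseteq> \<Omega> \<and>
     absorbing h V (ball 0 1) \<and> absorbing T (\<psi> ` V) \<Omega> \<and>
     (\<forall>z \<in> ball 0 1. \<psi> (h z) = T (\<psi> z)) \<and> inj_on \<psi> V"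

(* The Moebius map T of the right half-plane is taken in its normal form: conjugating it
   by an automorphism S of the half-plane amounts to replacing psi by S o psi. *)

definition hyperbolic_type :: "(complex \<Rightarrow> complex) \<Rightarrow> bool" where
  "hyperbolic_type h \<longleftrightarrow>
     (\<exists>V \<psi> (a::real). a > 1 \<and> Cowen_model h V {w. Re w > 0} \<psi> (\<lambda>w. of_real a * w))"

definition simply_parabolic_type :: "(complex \<Rightarrow> complex) \<Rightarrow> bool" where
  "simply_parabolic_type h \<longleftrightarrow>
     (\<exists>V \<psi>. Cowen_model h V {w. Re w > 0} \<psi> (\<lambda>w. w + \<i>) \<or>
            Cowen_model h V {w. Re w > 0} \<psi> (\<lambda>w. w - \<i>))"

definition hyperbolic_type_on :: "(complex \<Rightarrow> complex) \<Rightarrow> complex set \<Rightarrow> bool" where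
  "hyperbolic_type_on f U \<longleftrightarrow>
     (\<exists>\<phi>. riemann_map \<phi> U \<and> hyperbolic_type (associated_inner_function \<phi> f))"

definition simply_parabolic_type_on :: "(complex \<Rightarrow> complex) \<Rightarrow> complex set \<Rightarrow> bool" where
  "simply_parabolic_type_on f U \<longleftrightarrow>
     (\<exists>\<phi>. riemann_map \<phi> U \<and> simply_parabolic_type (associated_inner_function \<phi> f))"

end

(* Write g for the inner function associated with a Riemann map phi: D -> U, and z_n = g^n(0).
   Fix c outside U and let s be a holomorphic square root of phi - c. As s is injective and omits
   -s(D), q = eps / (s + s(0)) is, for small eps > 0, an injective holomorphic map of D into the closed unit
   disc, without zeros, and phi tends to infinity exactly where q tends to 0; in particular q(z_n) -> 0.

   The main estimate is that the mean of |q(g^n) - q(z_n)|^2 over the circle |z| = r is summable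
   over n, with a bound independent of r. Littlewood subordination bounds it by the sum of the
   |a_k|^2, k >= 1, where q o m = sum a_k z^k and m is the disc automorphism with m(0) = z_n, and this sum is at most
   (2/pi) times the integral of (1 - |z|^2) |(q o m)'|^2 over the disc. Changing variables by
   q o m turns it into the area integral over q(D) of the weight 1 - rho(z_n, v)^2 at q(v), rho being the
   pseudohyperbolic distance. By the Schwarz-Pick lemma for the semiconjugacy psi: D -> H of g to
   T, this weight is at most 1 - rho_H(T^n w_0, psi v)^2, and the sum over n of these is bounded, by
   explicit computation, when T is a dilation or a vertical translation of H. Since q(D) has
   finite area, the sum over n is finite. By Fatou's lemma, for almost every zeta the radial boundary
   values of q o g^n at zeta then differ from q(z_n) by a null sequence, so that those of
   f^n o phi = phi o g^n tend to infinity. *)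

theory Submission
  imports Defs
begin

section \<open>Change of variables for injective holomorphic maps\<close>

text \<open>Finite area is what makes the estimates for different n summable, and neither phi nor 1
  / (phi - c) need have an image of finite area: the complement of U may have empty interior. The
  square root repairs this, because s(D) misses a whole disc around -s(0). Working at the image
  point q(v) has a second advantage. In the disc the area integrals involve an automorphism that
  depends on n; on q(D) they all use the same Lebesgue measure and only the weight depends on n, so
  the weights can be added pointwise. The mean-square estimate controls q o g^n, whereas escape
  concerns the orbit under f of the boundary point w, the radial limit of phi. The link is
  continuity of f along the orbit of w, which could fail at a pole. But poles lie outside U, so they
  are values omitted by phi o g^n, and an omitted value is a radial limit on a null set of
  directions only; there are countably many poles and iterates. Polar coordinates are realised by
  exp on a half-strip, where circles and radii become vertical and horizontal lines and Tonelli's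
  theorem applies.\<close>

lemma borel_measurable_ennreal_times_indicator:
  fixes k :: "'a::topological_space \<Rightarrow> real"
  assumes "continuous_on S k" "S \<in> sets borel"
  shows "(\<lambda>y. ennreal (k y) * indicator S y) \<in> borel_measurable borel"
proof -
  have "(\<lambda>y. ennreal (indicator S y *\<^sub>R k y)) \<in> borel_measurable borel"
    by (rule measurable_compose[OF borel_measurable_continuous_on_indicator[OF assms(2,1)] measurable_ennreal])
  moreover have "(\<lambda>y. ennreal (indicator S y *\<^sub>R k y)) = (\<lambda>y. ennreal (k y) * indicator S y)"
    by (auto simp: fun_eq_iff indicator_def)
  ultimately show ?thesis by (simp only:)
qed

text \<open>The Jacobian formula \<open>has_measure_differentiable_image\<close> concerns maps of
  Cartesian spaces and determinants of matrices. This map and its inverse carry it over to the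
  complex plane.\<close>

definition complex_of_vec :: "real^2 \<Rightarrow> complex" where
  "complex_of_vec v = Complex (v $ 1) (v $ 2)"

definition vec_of_complex :: "complex \<Rightarrow> real^2" where
  "vec_of_complex z = vector [Re z, Im z]"

lemma complex_of_vec_of_complex [simp]: "complex_of_vec (vec_of_complex z) = z"
  by (simp add: complex_of_vec_def vec_of_complex_def)

lemma vec_of_complex_of_vec [simp]: "vec_of_complex (complex_of_vec v) = v"
  by (simp add: complex_of_vec_def vec_of_complex_def vec_eq_iff forall_2)

lemma bounded_linear_complex_of_vec: "bounded_linear complex_of_vec"
  unfolding complex_of_vec_def
  by (intro linear_conv_bounded_linear[THEN iffD1] linearI) (auto simp: complex_eq_iff)

lemma bounded_linear_vec_of_complex: "bounded_linear vec_of_complex"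
  unfolding vec_of_complex_def
  by (intro linear_conv_bounded_linear[THEN iffD1] linearI) (auto simp: vec_eq_iff forall_2)

lemma measurable_complex_of_vec [measurable]: "complex_of_vec \<in> borel_measurable borel"
  by (intro borel_measurable_continuous_onI linear_continuous_on bounded_linear_complex_of_vec)

text \<open>Lebesgue measure is determined by its values on boxes, and the preimage of a box is a
  box with the same side lengths. The same argument gives
  \<open>distr_lborel_Complex\<close>.\<close>

lemma distr_lborel_complex_of_vec: "distr lborel borel complex_of_vec = lborel"
proof (rule lborel_eqI[symmetric])
  fix l u :: complex
  assume le: "\<And>b. b \<in> Basis \<Longrightarrow> l \<bullet> b \<le> u \<bullet> b"
  have Basis2: "(Basis :: (real^2) set) = {axis 1 1, axis 2 1}"
    by (auto simp: Basis_vec_def UNIV_2)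
  have ne: "axis 1 1 \<noteq> (axis 2 1 :: real^2)" by (simp add: axis_eq_axis)
  have vi: "complex_of_vec -` box l u = box (vec_of_complex l) (vec_of_complex u)"
    by (auto simp: complex_of_vec_def vec_of_complex_def box_def Basis2 Basis_complex_def inner_axis inner_complex_def)
  have "emeasure (distr lborel borel complex_of_vec) (box l u) = emeasure lborel (box (vec_of_complex l) (vec_of_complex u))"
    by (simp add: emeasure_distr vi)
  also have "\<dots> = (\<Prod>b\<in>Basis. (u - l) \<bullet> b)"
    using le[of 1] le[of \<i>] ne
    by (auto simp: emeasure_lborel_box_eq Basis2 Basis_complex_def inner_axis vec_of_complex_def inner_complex_def)
  finally show "emeasure (distr lborel borel complex_of_vec) (box l u) = (\<Prod>b\<in>Basis. (u - l) \<bullet> b)" .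
qed simp

lemma distr_lborel_Complex: "distr lborel borel (\<lambda>(x,y). Complex x y) = lborel"
proof (rule lborel_eqI[symmetric])
  have m: "(\<lambda>(x,y). Complex x y) \<in> borel_measurable borel"
    by (intro borel_measurable_continuous_onI) (auto simp: case_prod_beta Complex_eq intro!: continuous_intros)
  fix l u :: complex
  assume le: "\<And>b. b \<in> Basis \<Longrightarrow> l \<bullet> b \<le> u \<bullet> b"
  have vi: "(\<lambda>(x,y). Complex x y) -` box l u = box (Re l) (Re u) \<times> box (Im l) (Im u)"
    by (auto simp: box_def Basis_complex_def inner_complex_def)
  have "emeasure (distr lborel borel (\<lambda>(x,y). Complex x y)) (box l u) = emeasure (lborel \<Otimes>\<^sub>M lborel) (box (Re l) (Re u) \<times> box (Im l) (Im u))"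
    using m by (simp add: emeasure_distr vi lborel_prod)
  also have "\<dots> = (\<Prod>b\<in>Basis. (u - l) \<bullet> b)"
    using le[of 1] le[of \<i>]
    by (simp add: lborel.emeasure_pair_measure_Times emeasure_lborel_box_eq Basis_complex_def inner_complex_def ennreal_mult)
  finally show "emeasure (distr lborel borel (\<lambda>(x,y). Complex x y)) (box l u) = (\<Prod>b\<in>Basis. (u - l) \<bullet> b)" .
qed simp

text \<open>Both orders are used in logarithmic coordinates: with the inner integral over x the
  integration runs along radii (existence of radial limits), with the inner integral over y along
  circles (coefficient estimates).\<close>

lemma nn_integral_lborel_Complex:
  assumes [measurable]: "h \<in> borel_measurable borel"
  shows "(\<integral>\<^sup>+z. h z \<partial>lborel) = (\<integral>\<^sup>+y. \<integral>\<^sup>+x. h (Complex x y) \<partial>lborel \<partial>lborel)"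
    and "(\<integral>\<^sup>+z. h z \<partial>lborel) = (\<integral>\<^sup>+x. \<integral>\<^sup>+y. h (Complex x y) \<partial>lborel \<partial>lborel)"
proof -
  have m: "(\<lambda>(x,y). Complex x y) \<in> borel_measurable borel"
    by (intro borel_measurable_continuous_onI) (auto simp: case_prod_beta Complex_eq intro!: continuous_intros)
  then have [measurable]: "(\<lambda>(x,y). Complex x y) \<in> borel_measurable (lborel \<Otimes>\<^sub>M lborel)"
    by (simp add: lborel_prod)
  have eq: "(\<integral>\<^sup>+z. h z \<partial>lborel) = (\<integral>\<^sup>+p. h (case p of (x,y) \<Rightarrow> Complex x y) \<partial>(lborel \<Otimes>\<^sub>M lborel))"
    using m by (subst distr_lborel_Complex[symmetric], subst nn_integral_distr) (auto simp: lborel_prod)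
  show "(\<integral>\<^sup>+z. h z \<partial>lborel) = (\<integral>\<^sup>+y. \<integral>\<^sup>+x. h (Complex x y) \<partial>lborel \<partial>lborel)"
    unfolding eq by (subst lborel_pair.nn_integral_snd[symmetric]) auto
  show "(\<integral>\<^sup>+z. h z \<partial>lborel) = (\<integral>\<^sup>+x. \<integral>\<^sup>+y. h (Complex x y) \<partial>lborel \<partial>lborel)"
    unfolding eq by (subst lborel.nn_integral_fst[symmetric]) auto
qed

text \<open>By the Cauchy-Riemann equations the real Jacobian of a holomorphic map is the squared
  modulus of its derivative. Boundedness of the image supplies the finite measure that the
  real-variable theorem asks of the image set.\<close>

lemma emeasure_image_holomorphic:
  assumes S: "open S" and hol: "u holomorphic_on S" and inj: "inj_on u S" and bnd: "bounded (u ` S)"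
    and B: "B \<in> sets borel"
  shows "(\<integral>\<^sup>+z\<in>S \<inter> u -` B. ennreal ((norm (deriv u z))\<^sup>2) \<partial>lborel) = emeasure lborel (u ` S \<inter> B)"
proof -
  define A where "A = S \<inter> u -` B"
  define F where "F = vec_of_complex \<circ> u \<circ> complex_of_vec"
  define F' where "F' v = vec_of_complex \<circ> (\<lambda>h. deriv u (complex_of_vec v) * h) \<circ> complex_of_vec" for v
  define A' where "A' = complex_of_vec -` A"
  \<comment> \<open>The cut-off is there for measurability on the whole plane: nothing is known
    about \<open>u\<close> outside \<open>S\<close>.\<close>
  define d where "d z = indicator S z * (norm (deriv u z))\<^sup>2" for z
  have cont: "continuous_on S u" using hol holomorphic_on_imp_continuous_on by blast
  have [measurable]: "S \<in> sets borel" using S by auto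
  have um: "(\<lambda>z. indicator S z *\<^sub>R u z) \<in> borel_measurable borel"
    using cont S by (intro borel_measurable_continuous_on_indicator) auto
  have "A = S \<inter> (\<lambda>z. indicator S z *\<^sub>R u z) -` B" by (auto simp: A_def)
  then have A[measurable]: "A \<in> sets borel"
    using measurable_sets_borel[OF um B] S by auto
  have "continuous_on S (\<lambda>z. (norm (deriv u z))\<^sup>2)"
    by (intro continuous_intros holomorphic_on_imp_continuous_on holomorphic_deriv hol S)
  then have dm[measurable]: "d \<in> borel_measurable borel"
    unfolding d_def using borel_measurable_continuous_on_indicator[of S "\<lambda>z. (norm (deriv u z))\<^sup>2"] by simp
  have A'm: "A' \<in> sets borel" unfolding A'_def by (rule measurable_sets_borel[OF measurable_complex_of_vec A])
  have der: "(F has_derivative F' v) (at v within A')" if "v \<in> A'" for v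
  proof -
    have "(u has_field_derivative deriv u (complex_of_vec v)) (at (complex_of_vec v))"
      using that hol S unfolding A'_def A_def by (auto intro: holomorphic_derivI)
    then have "(u has_derivative (\<lambda>h. deriv u (complex_of_vec v) * h)) (at (complex_of_vec v))"
      by (simp add: has_field_derivative_def)
    then have "(F has_derivative F' v) (at v)"
      unfolding F_def F'_def comp_def
      by (intro bounded_linear.has_derivative[OF bounded_linear_vec_of_complex]
          has_derivative_compose[OF bounded_linear_imp_has_derivative[OF bounded_linear_complex_of_vec]])
    then show ?thesis by (rule has_derivative_at_withinI)
  qed
  have detF: "\<bar>det (matrix (F' v))\<bar> = d (complex_of_vec v)" if "v \<in> A'" for v
  proof -
    \<comment> \<open>Multiplication by a complex number a, as a real 2x2 matrix, has determinant
      |a|^2.\<close>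
    have "det (matrix (F' v)) = (norm (deriv u (complex_of_vec v)))\<^sup>2"
      unfolding F'_def by (simp add: det_2 matrix_def vec_of_complex_def complex_of_vec_def axis_def cmod_power2) (simp add: power2_eq_square)
    then show ?thesis using that by (simp add: d_def A'_def A_def)
  qed
  have injF: "inj_on F A'"
  proof (rule inj_onI)
    fix x y assume xy: "x \<in> A'" "y \<in> A'" "F x = F y"
    then have "u (complex_of_vec x) = u (complex_of_vec y)"
      unfolding F_def comp_def by (metis complex_of_vec_of_complex)
    then have "complex_of_vec x = complex_of_vec y" using xy inj unfolding A'_def A_def inj_on_def by blast
    then show "x = y" by (metis vec_of_complex_of_vec)
  qed
  have oi: "open (u ` S)" using open_mapping_thm3[OF hol S inj] .
  have FA: "F ` A' = complex_of_vec -` (u ` S \<inter> B)"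
  proof (intro set_eqI iffI)
    fix v assume "v \<in> F ` A'" then show "v \<in> complex_of_vec -` (u ` S \<inter> B)"
      unfolding F_def A'_def A_def by auto
  next
    fix v assume "v \<in> complex_of_vec -` (u ` S \<inter> B)"
    then obtain z where z: "z \<in> S" "complex_of_vec v = u z" "u z \<in> B" by auto
    have "v = F (vec_of_complex z)" by (simp add: F_def z(2)[symmetric])
    moreover have "vec_of_complex z \<in> A'" unfolding A'_def A_def using z by auto
    ultimately show "v \<in> F ` A'" by blast
  qed
  have FAm: "F ` A' \<in> sets borel" unfolding FA using oi B
    by (intro measurable_sets_borel[OF measurable_complex_of_vec] sets.Int) auto
  have fin: "emeasure lborel (u ` S \<inter> B) < \<infinity>"
    using bnd by (intro emeasure_bounded_finite) (auto intro: bounded_Int)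
  have "emeasure (distr lborel borel complex_of_vec) (u ` S \<inter> B) = emeasure lborel (F ` A')"
    unfolding FA using oi B by (subst emeasure_distr) auto
  then have em: "emeasure lborel (F ` A') = emeasure lborel (u ` S \<inter> B)"
    by (simp add: distr_lborel_complex_of_vec)
  have lm: "F ` A' \<in> lmeasurable" using em fin FAm
    by (intro fmeasurableI) auto
  have "((\<lambda>x. \<bar>det (matrix (F' x))\<bar>) has_integral measure lebesgue (F ` A')) A'"
    using has_measure_differentiable_image[of A' F F' "measure lebesgue (F ` A')"] A'm der injF lm by auto
  then have hi0: "((\<lambda>v. d (complex_of_vec v)) has_integral measure lebesgue (F ` A')) A'"
    using has_integral_cong[of A' "\<lambda>x. \<bar>det (matrix (F' x))\<bar>" "\<lambda>v. d (complex_of_vec v)"] detF by blast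
  have hi: "((\<lambda>v. indicator A' v * d (complex_of_vec v)) has_integral measure lebesgue (F ` A')) UNIV"
    if "((\<lambda>v. d (complex_of_vec v)) has_integral measure lebesgue (F ` A')) A'"
  proof -
    have "(\<lambda>v. indicator A' v * d (complex_of_vec v)) = (\<lambda>v. if v \<in> A' then d (complex_of_vec v) else 0)"
      by (auto simp: fun_eq_iff)
    then show ?thesis using that by (simp only: has_integral_restrict_UNIV)
  qed
  have "(\<lambda>v. indicator A' v * d (complex_of_vec v)) \<in> borel_measurable borel" using A'm by measurable
  then have "(\<integral>\<^sup>+v. ennreal (indicator A' v * d (complex_of_vec v)) \<partial>lborel) = ennreal (measure lebesgue (F ` A'))"
    using hi[OF hi0] by (intro nn_integral_has_integral_lborel) (auto simp: d_def)
  also have "\<dots> = emeasure lborel (F ` A')"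
    using lm FAm emeasure_eq_measure2[OF lm] by simp
  finally have 1: "(\<integral>\<^sup>+v. ennreal (indicator A' v * d (complex_of_vec v)) \<partial>lborel) = emeasure lborel (u ` S \<inter> B)"
    using em by simp
  have "(\<integral>\<^sup>+z\<in>A. ennreal ((norm (deriv u z))\<^sup>2) \<partial>lborel) = (\<integral>\<^sup>+z. ennreal (indicator A z * d z) \<partial>lborel)"
    by (intro nn_integral_cong) (auto simp: d_def A_def indicator_def)
  also have "\<dots> = (\<integral>\<^sup>+v. ennreal (indicator A (complex_of_vec v) * d (complex_of_vec v)) \<partial>lborel)"
    by (subst distr_lborel_complex_of_vec[symmetric], subst nn_integral_distr) auto
  also have "\<dots> = (\<integral>\<^sup>+v. ennreal (indicator A' v * d (complex_of_vec v)) \<partial>lborel)"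
    by (simp add: A'_def indicator_def)
  finally show ?thesis using 1 A_def by simp
qed

lemma nn_integral_holomorphic_change_of_variables:
  fixes h :: "complex \<Rightarrow> ennreal"
  assumes S: "open S" and hol: "u holomorphic_on S" and inj: "inj_on u S" and bnd: "bounded (u ` S)"
    and h [measurable]: "h \<in> borel_measurable borel"
  shows "(\<integral>\<^sup>+z\<in>S. h (u z) * ennreal ((norm (deriv u z))\<^sup>2) \<partial>lborel) = (\<integral>\<^sup>+y\<in>u ` S. h y \<partial>lborel)"
proof -
  define d where "d z = ennreal ((norm (deriv u z))\<^sup>2) * indicator S z" for z
  \<comment> \<open>A Borel version of \<open>u\<close>; its value 0 off \<open>S\<close> is
    harmless because the density \<open>d\<close> vanishes there.\<close>
  define u' where "u' z = (if z \<in> S then u z else 0)" for z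
  have [measurable]: "S \<in> sets borel" "u ` S \<in> sets borel"
    using S open_mapping_thm3[OF hol S inj] by auto
  have "continuous_on S (\<lambda>z. (norm (deriv u z))\<^sup>2)"
    by (intro continuous_intros holomorphic_on_imp_continuous_on holomorphic_deriv hol S)
  then have [measurable]: "d \<in> borel_measurable borel"
    unfolding d_def by (rule borel_measurable_ennreal_times_indicator) simp
  have "continuous_on S u" using hol holomorphic_on_imp_continuous_on by blast
  then have "(\<lambda>z. indicator S z *\<^sub>R u z) \<in> borel_measurable borel"
    by (intro borel_measurable_continuous_on_indicator) auto
  moreover have "u' = (\<lambda>z. indicator S z *\<^sub>R u z)" by (auto simp: u'_def fun_eq_iff)
  ultimately have [measurable]: "u' \<in> borel_measurable borel" by simp
  have eq: "distr (density lborel d) borel u' = density lborel (indicator (u ` S))"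
  proof (rule measure_eqI)
    fix B assume "B \<in> sets (distr (density lborel d) borel u')"
    then have B[measurable]: "B \<in> sets borel" by simp
    have "emeasure (distr (density lborel d) borel u') B = (\<integral>\<^sup>+z. d z * indicator (u' -` B) z \<partial>lborel)"
      using measurable_sets_borel[of u' borel B] by (simp add: emeasure_distr emeasure_density)
    also have "\<dots> = (\<integral>\<^sup>+z\<in>S \<inter> u -` B. ennreal ((norm (deriv u z))\<^sup>2) \<partial>lborel)"
      by (intro nn_integral_cong) (auto simp: d_def u'_def indicator_def)
    also have "\<dots> = emeasure lborel (u ` S \<inter> B)"
      by (rule emeasure_image_holomorphic) fact+
    also have "\<dots> = emeasure (density lborel (indicator (u ` S))) B"
      by (simp add: emeasure_density indicator_inter_arith[symmetric])
    finally show "emeasure (distr (density lborel d) borel u') B = emeasure (density lborel (indicator (u ` S))) B" .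
  qed simp
  have "(\<integral>\<^sup>+z\<in>S. h (u z) * ennreal ((norm (deriv u z))\<^sup>2) \<partial>lborel) = (\<integral>\<^sup>+z. d z * h (u' z) \<partial>lborel)"
    by (intro nn_integral_cong) (auto simp: d_def u'_def indicator_def mult.commute)
  also have "\<dots> = (\<integral>\<^sup>+z. h z \<partial>distr (density lborel d) borel u')"
    by (simp add: nn_integral_distr nn_integral_density)
  also have "\<dots> = (\<integral>\<^sup>+y\<in>u ` S. h y \<partial>lborel)"
    unfolding eq by (simp add: nn_integral_density mult.commute)
  finally show ?thesis .
qed

section \<open>Square means on circles\<close>

text \<open>Not normalised: this is 2 pi times the mean square on the circle of radius
  \<open>r\<close>, the source of the factors \<open>2*pi\<close> below.\<close>

definition circle_norm2 :: "real \<Rightarrow> (complex \<Rightarrow> complex) \<Rightarrow> real" where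
  "circle_norm2 r G = integral {0..2*pi} (\<lambda>t. (norm (G (of_real r * cis t)))\<^sup>2)"

lemma continuous_on_circle:
  fixes G :: "complex \<Rightarrow> 'a::topological_space"
  assumes "continuous_on (ball 0 1) G" "0 \<le> r" "r < 1"
  shows "continuous_on A (\<lambda>t. G (of_real r * cis t))"
  by (rule continuous_on_compose2[OF assms(1)])
     (use assms(2,3) in \<open>auto intro!: continuous_intros simp: norm_mult\<close>)

text \<open>Cauchy's integral formula at the centre, with the parameter interval of
  \<open>circlepath\<close> stretched from \<open>{0..1}\<close> to \<open>{0..2*pi}\<close>. Radius
  0 is separate because the contour collapses.\<close>

lemma circle_mean_value:
  assumes G: "G holomorphic_on ball 0 1" and r: "0 \<le> r" "r < 1"
  shows "((\<lambda>t. G (of_real r * cis t)) has_integral of_real (2*pi) * G 0) {0..2*pi}"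
proof (cases "r = 0")
  case True
  then show ?thesis using has_integral_const_real[of "G 0" 0 "2*pi"] by (simp add: scaleR_conv_of_real)
next
  case False
  then have r0: "r > 0" using r by simp
  have "((\<lambda>u. G u / (u - 0)) has_contour_integral 2 * of_real pi * \<i> * G 0) (circlepath 0 r)"
    by (rule Cauchy_integral_circlepath_simple) (use r r0 G in \<open>auto intro!: holomorphic_on_subset[OF G]\<close>)
  then have "((\<lambda>t. G (of_real r * cis (2*pi*t)) * (2 * of_real pi * \<i>)) has_integral 2 * of_real pi * \<i> * G 0) {0..1}"
    unfolding has_contour_integral
  proof (rule has_integral_eq[rotated])
    fix x :: real
    have c: "circlepath 0 r x = of_real r * cis (2*pi*x)"
      by (simp add: circlepath cis_conv_exp mult_ac)
    have vd: "vector_derivative (circlepath 0 r) (at x) = 2 * of_real pi * \<i> * (of_real r * cis (2*pi*x))"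
      by (subst vector_derivative_circlepath) (simp add: cis_conv_exp mult_ac)
    show "G (circlepath 0 r x) / (circlepath 0 r x - 0) * vector_derivative (circlepath 0 r) (at x) =
        G (of_real r * cis (2*pi*x)) * (2 * of_real pi * \<i>)"
      unfolding c vd using r0 by simp
  qed
  from has_integral_mult_right[OF this, of "inverse \<i>"]
  have "((\<lambda>t. of_real (2*pi) * G (of_real r * cis (2*pi*t))) has_integral of_real (2*pi) * G 0) {0..1}"
    by (simp add: mult_ac)
  from has_integral_mult_right[OF this, of "1 / of_real (2*pi)"]
  have "((\<lambda>t. G (of_real r * cis (2*pi*t))) has_integral G 0) {0..1}"
    by simp
  from has_integral_stretch_real[OF this[unfolded box_real], of "1 / (2*pi)"]
  show ?thesis by (simp add: scaleR_conv_of_real image_mult_atLeastAtMost mult.commute[of _ "2*pi"])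
qed

text \<open>Constants are orthogonal to functions vanishing at 0: the cross term is the real part of
  the holomorphic function \<open>cnj c * W z\<close>, whose mean over the circle is its value at
  the centre.\<close>

lemma circle_norm2_add_const:
  assumes W: "W holomorphic_on ball 0 1" "W 0 = 0" and r: "0 \<le> r" "r < 1"
  shows "circle_norm2 r (\<lambda>z. c + W z) = 2*pi*(norm c)\<^sup>2 + circle_norm2 r W"
proof -
  have cW: "continuous_on (ball 0 1) W" using W holomorphic_on_imp_continuous_on by blast
  have "((\<lambda>t. Re (cnj c * W (of_real r * cis t))) has_integral Re (of_real (2*pi) * (cnj c * W 0))) {0..2*pi}"
    by (intro has_integral_Re circle_mean_value r holomorphic_intros W)
  from has_integral_mult_right[OF this, of 2]
  have 1: "((\<lambda>t. 2 * Re (cnj c * W (of_real r * cis t))) has_integral 0) {0..2*pi}"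
    unfolding W(2) by (simp only: mult_zero_right zero_complex.sel)
  have 2: "((\<lambda>t. (norm (W (of_real r * cis t)))\<^sup>2) has_integral circle_norm2 r W) {0..2*pi}"
    unfolding circle_norm2_def
    by (intro integrable_integral integrable_continuous_real continuous_intros continuous_on_circle[OF cW] r)
  have 3: "((\<lambda>t. (norm c)\<^sup>2) has_integral 2*pi*(norm c)\<^sup>2) {0..2*pi}"
    using has_integral_const_real[of "(norm c)\<^sup>2" 0 "2*pi"] by simp
  have eq: "(norm (c + w))\<^sup>2 = (norm c)\<^sup>2 + (2 * Re (cnj c * w) + (norm w)\<^sup>2)" for w
    unfolding cmod_power2 by (simp add: power2_eq_square algebra_simps)
  have "((\<lambda>t. (norm (c + W (of_real r * cis t)))\<^sup>2) has_integral 2*pi*(norm c)\<^sup>2 + (0 + circle_norm2 r W)) {0..2*pi}"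
    unfolding eq by (intro has_integral_add 1 2 3)
  then show ?thesis by (simp add: circle_norm2_def integral_unique)
qed

lemma circle_norm2_mono:
  assumes "continuous_on (ball 0 1) F" "continuous_on (ball 0 1) G" and r: "0 \<le> r" "r < 1"
    and "\<And>z. norm z = r \<Longrightarrow> norm (F z) \<le> norm (G z)"
  shows "circle_norm2 r F \<le> circle_norm2 r G"
  unfolding circle_norm2_def
proof (rule integral_le)
  show "(\<lambda>t. (norm (F (of_real r * cis t)))\<^sup>2) integrable_on {0..2*pi}"
    "(\<lambda>t. (norm (G (of_real r * cis t)))\<^sup>2) integrable_on {0..2*pi}"
    by (intro integrable_continuous_real continuous_intros continuous_on_circle assms)+
  show "(norm (F (of_real r * cis t)))\<^sup>2 \<le> (norm (G (of_real r * cis t)))\<^sup>2" for t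
    using r assms(5)[of "of_real r * cis t"] by (intro power_mono) (auto simp: norm_mult)
qed

lemma circle_norm2_cmult: "circle_norm2 r (\<lambda>z. c * G z) = (norm c)\<^sup>2 * circle_norm2 r G"
  by (simp add: circle_norm2_def norm_mult power_mult_distrib)

lemma circle_norm2_nonneg: "circle_norm2 r G \<ge> 0"
  unfolding circle_norm2_def
  by (cases "(\<lambda>t. (norm (G (of_real r * cis t)))\<^sup>2) integrable_on {0..2*pi}")
     (auto intro: integral_nonneg simp: not_integrable_integral)

text \<open>The coefficients are a parameter, so that the results apply to a function and, through
  \<open>deriv_power_series\<close>, to its derivative as well.\<close>

locale disc_power_series =
  fixes F :: "complex \<Rightarrow> complex" and c :: "nat \<Rightarrow> complex"
  assumes sums: "\<And>z. norm z < 1 \<Longrightarrow> (\<lambda>k. c k * z ^ k) sums F z"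
begin

text \<open>The iterated backward shift: the remainder of the series after \<open>m\<close> terms,
  divided by z^m. Removing one coefficient at a time in this way takes the place of Parseval's
  identity and works equally well after composition with a Schwarz function.\<close>

definition shifted :: "nat \<Rightarrow> complex \<Rightarrow> complex" where
  "shifted m z = (\<Sum>k. c (m + k) * z ^ k)"

lemma summable_norm_coeff: "0 \<le> r \<Longrightarrow> r < 1 \<Longrightarrow> summable (\<lambda>k. norm (c k) * r ^ k)"
proof -
  assume r: "0 \<le> r" "r < 1"
  define s where "s = (r + 1) / 2"
  have s: "r < s" "0 \<le> s" "s < 1" using r by (auto simp: s_def)
  have "summable (\<lambda>k. c k * of_real s ^ k)" using sums[of "of_real s"] s sums_summable by auto
  then have "summable (\<lambda>k. norm (c k * of_real r ^ k))"
    by (rule powser_insidea) (use s r in auto)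
  then show ?thesis using r by (simp add: norm_mult norm_power)
qed

lemma summable_norm_shifted: "0 \<le> r \<Longrightarrow> r < 1 \<Longrightarrow> summable (\<lambda>k. norm (c (m + k)) * r ^ k)"
proof (cases "r = 0")
  case False
  assume r: "0 \<le> r" "r < 1"
  have "summable (\<lambda>k. norm (c (k + m)) * r ^ (k + m))"
    using summable_norm_coeff[OF r] by (subst summable_iff_shift)
  from summable_mult[OF this, of "1 / r ^ m"] show ?thesis
    using False by (simp add: power_add add.commute)
qed auto

lemma shifted_sums:
  assumes "norm z < 1" shows "(\<lambda>k. c (m + k) * z ^ k) sums shifted m z"
proof -
  have "summable (\<lambda>k. norm (c (m + k) * z ^ k))"
    using summable_norm_shifted[of "norm z" m] assms by (simp add: norm_mult norm_power)
  then show ?thesis unfolding shifted_def by (rule summable_sums[OF summable_norm_cancel])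
qed

lemma shifted_0: "norm z < 1 \<Longrightarrow> shifted 0 z = F z"
  using sums_unique[OF sums] by (simp add: shifted_def)

lemma shifted_Suc:
  assumes "norm z < 1" shows "shifted m z = c m + z * shifted (Suc m) z"
proof -
  have "shifted m z = c (m + 0) * z ^ 0 + (\<Sum>k. c (m + Suc k) * z ^ Suc k)"
    unfolding shifted_def using suminf_split_head[OF sums_summable[OF shifted_sums[OF assms]], of m] by simp
  also have "(\<Sum>k. c (m + Suc k) * z ^ Suc k) = z * shifted (Suc m) z"
    using suminf_mult[OF sums_summable[OF shifted_sums[OF assms]], of z "Suc m"]
    unfolding shifted_def by (simp add: mult_ac)
  finally show ?thesis by simp
qed

lemma holomorphic_shifted: "shifted m holomorphic_on ball 0 1"
  by (rule power_series_holomorphic[of _ _ "\<lambda>k. c (m + k)"]) (simp add: shifted_sums)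

text \<open>The constant coefficient splits off orthogonally, and the remaining factor
  \<open>z\<close> has constant modulus \<open>r\<close> on the circle.\<close>

lemma circle_norm2_shifted:
  assumes r: "0 \<le> r" "r < 1"
  shows "circle_norm2 r (shifted m) = 2*pi*(norm (c m))\<^sup>2 + r\<^sup>2 * circle_norm2 r (shifted (Suc m))"
proof -
  have "circle_norm2 r (shifted m) = circle_norm2 r (\<lambda>z. c m + z * shifted (Suc m) z)"
    unfolding circle_norm2_def
    using r by (intro integral_cong) (simp add: norm_mult shifted_Suc[of _ m])
  also have "\<dots> = 2*pi*(norm (c m))\<^sup>2 + circle_norm2 r (\<lambda>z. z * shifted (Suc m) z)"
    by (intro circle_norm2_add_const r holomorphic_intros holomorphic_shifted) auto
  also have "circle_norm2 r (\<lambda>z. z * shifted (Suc m) z) = circle_norm2 r (\<lambda>z. of_real r * shifted (Suc m) z)"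
    unfolding circle_norm2_def using r by (intro integral_cong) (simp add: norm_mult)
  finally show ?thesis using r by (simp add: circle_norm2_cmult)
qed

lemma Bessel_inequality:
  assumes r: "0 \<le> r" "r < 1"
  shows "2*pi*(\<Sum>k<n. (norm (c k))\<^sup>2 * r ^ (2*k)) \<le> circle_norm2 r F"
proof -
  have "circle_norm2 r (shifted 0) = 2*pi*(\<Sum>k<n. (norm (c k))\<^sup>2 * r ^ (2*k)) + r ^ (2*n) * circle_norm2 r (shifted n)"
  proof (induction n)
    case (Suc n)
    then show ?case using circle_norm2_shifted[OF r, of n]
      by (simp add: algebra_simps power2_eq_square)
  qed simp
  moreover have "circle_norm2 r (shifted 0) = circle_norm2 r F"
    unfolding circle_norm2_def using r by (intro integral_cong) (simp add: shifted_0 norm_mult)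
  moreover have "0 \<le> r ^ (2*n) * circle_norm2 r (shifted n)"
    using r circle_norm2_nonneg by simp
  ultimately show ?thesis by linarith
qed

text \<open>The peeling of coefficients survives composition with \<open>w\<close>: since
  \<open>w 0 = 0\<close>, each coefficient is still orthogonal to the rest, and the factor
  \<open>w z\<close>, which replaces \<open>z\<close>, has modulus at most \<open>r\<close> on the
  circle. This time an upper bound is wanted, so the remainder must be shown to tend to 0 instead of
  being dropped.\<close>

lemma Littlewood_subordination:
  assumes w: "w holomorphic_on ball 0 1" "\<And>z. norm z < 1 \<Longrightarrow> norm (w z) \<le> norm z"
    and r: "0 \<le> r" "r < 1" and B: "\<And>n. (\<Sum>k<n. (norm (c (Suc k)))\<^sup>2) \<le> B"
  shows "circle_norm2 r (\<lambda>z. F (w z) - c 0) \<le> 2*pi*B"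
proof -
  have w0: "w 0 = 0" using w(2)[of 0] by simp
  have wb: "norm (w z) < 1" if "norm z < 1" for z using w(2)[OF that] that by simp
  have holS: "(\<lambda>z. shifted m (w z)) holomorphic_on ball 0 1" for m
  proof -
    have "w ` ball 0 1 \<subseteq> ball 0 1" using wb by auto
    from holomorphic_on_compose_gen[OF w(1) holomorphic_shifted this, of m] show ?thesis
      by (simp add: comp_def)
  qed
  note contS = holomorphic_on_imp_continuous_on[OF holS]
  have step: "circle_norm2 r (\<lambda>z. w z * shifted m (w z)) \<le> r\<^sup>2 * (2*pi*(norm (c m))\<^sup>2 + circle_norm2 r (\<lambda>z. w z * shifted (Suc m) (w z)))" for m
  proof -
    have "circle_norm2 r (\<lambda>z. w z * shifted m (w z)) \<le> circle_norm2 r (\<lambda>z. of_real r * shifted m (w z))"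
      by (intro circle_norm2_mono continuous_intros contS holomorphic_on_imp_continuous_on[OF w(1)] r)
         (use w(2) r in \<open>auto simp: norm_mult intro!: mult_right_mono\<close>)
    also have "\<dots> = r\<^sup>2 * circle_norm2 r (\<lambda>z. shifted m (w z))" using r by (simp add: circle_norm2_cmult)
    also have "circle_norm2 r (\<lambda>z. shifted m (w z)) = circle_norm2 r (\<lambda>z. c m + w z * shifted (Suc m) (w z))"
      unfolding circle_norm2_def using r by (intro integral_cong) (simp add: shifted_Suc[of _ m] wb norm_mult)
    also have "\<dots> = 2*pi*(norm (c m))\<^sup>2 + circle_norm2 r (\<lambda>z. w z * shifted (Suc m) (w z))"
      by (intro circle_norm2_add_const r holomorphic_intros w holS) (simp add: w0)
    finally show ?thesis .
  qed
  have iter: "circle_norm2 r (\<lambda>z. w z * shifted 1 (w z)) \<le> 2*pi*(\<Sum>k<n. (norm (c (Suc k)))\<^sup>2)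
      + r ^ (2*n) * circle_norm2 r (\<lambda>z. w z * shifted (Suc n) (w z))" for n
  proof (induction n)
    case (Suc n)
    have "r ^ (2*n) * circle_norm2 r (\<lambda>z. w z * shifted (Suc n) (w z)) \<le>
       r ^ (2*n) * (r\<^sup>2 * (2*pi*(norm (c (Suc n)))\<^sup>2 + circle_norm2 r (\<lambda>z. w z * shifted (Suc (Suc n)) (w z))))"
      by (intro mult_left_mono step) (use r in auto)
    also have "\<dots> = r ^ (2*n+2) * (2*pi*(norm (c (Suc n)))\<^sup>2) + r ^ (2*Suc n) * circle_norm2 r (\<lambda>z. w z * shifted (Suc (Suc n)) (w z))"
      by (simp add: algebra_simps power2_eq_square)
    \<comment> \<open>The power of \<open>r\<close> is given away, so that the final bound does not
      depend on the radius.\<close>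
    also have "r ^ (2*n+2) * (2*pi*(norm (c (Suc n)))\<^sup>2) \<le> 2*pi*(norm (c (Suc n)))\<^sup>2"
    proof (rule mult_left_le_one_le)
      show "r ^ (2*n+2) \<le> 1" using r by (intro power_le_one) auto
    qed (use r in auto)
    finally show ?case using Suc by (simp add: algebra_simps)
  qed simp
  \<comment> \<open>A tail of the absolutely convergent series at radius \<open>r\<close>. It
    dominates r^n |w| |shifted (Suc n) o w| on the circle: \<open>n\<close> of the powers of
    \<open>r\<close> come from the iteration, and one more from |w| \<le> r.\<close>
  define tail where "tail n = (\<Sum>k. norm (c (k + Suc n)) * r ^ (k + Suc n))" for n
  have tail0: "tail \<longlonglongrightarrow> 0"
    unfolding tail_def using LIMSEQ_Suc[OF suminf_exist_split2[OF summable_norm_coeff[OF r]]] by simp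
  have bound: "r ^ (2*n) * circle_norm2 r (\<lambda>z. w z * shifted (Suc n) (w z)) \<le> 2*pi*(tail n)\<^sup>2" for n
  proof -
    have tn: "r ^ n * norm (w z * shifted (Suc n) (w z)) \<le> tail n" if z: "norm z = r" for z
    proof -
      have sm: "summable (\<lambda>k. norm (c (Suc n + k)) * r ^ k)" by (rule summable_norm_shifted[OF r])
      have "norm (shifted (Suc n) (w z)) \<le> (\<Sum>k. norm (c (Suc n + k)) * r ^ k)"
        unfolding shifted_def
      proof (rule norm_suminf_le[OF _ sm])
        show "norm (c (Suc n + k) * w z ^ k) \<le> norm (c (Suc n + k)) * r ^ k" for k
          using w(2)[of z] z r by (auto simp: norm_mult norm_power intro!: mult_left_mono power_mono)
      qed
      then have "r ^ Suc n * norm (shifted (Suc n) (w z)) \<le> r ^ Suc n * (\<Sum>k. norm (c (Suc n + k)) * r ^ k)"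
        using r by (intro mult_left_mono) auto
      also have "\<dots> = tail n"
        unfolding tail_def using sm by (subst suminf_mult[symmetric]) (auto simp: power_add mult_ac add_ac)
      finally have 1: "r ^ Suc n * norm (shifted (Suc n) (w z)) \<le> tail n" .
      have "r ^ n * norm (w z * shifted (Suc n) (w z)) \<le> r ^ n * (r * norm (shifted (Suc n) (w z)))"
        using w(2)[of z] z r by (auto simp: norm_mult intro!: mult_left_mono mult_right_mono)
      with 1 show ?thesis by (simp add: mult_ac)
    qed
    have "0 \<le> r ^ n * norm (w (of_real r) * shifted (Suc n) (w (of_real r)))" using r by simp
    also have "\<dots> \<le> tail n" using r by (intro tn) simp
    finally have tpos: "0 \<le> tail n" .
    have "r ^ (2*n) * circle_norm2 r (\<lambda>z. w z * shifted (Suc n) (w z)) = circle_norm2 r (\<lambda>z. of_real r ^ n * (w z * shifted (Suc n) (w z)))"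
      using r by (subst circle_norm2_cmult) (simp add: norm_power power_mult[symmetric] mult.commute)
    also have "\<dots> \<le> circle_norm2 r (\<lambda>z. of_real (tail n))"
      by (intro circle_norm2_mono continuous_intros contS holomorphic_on_imp_continuous_on[OF w(1)] r)
         (use tn r tpos in \<open>auto simp: norm_mult norm_power\<close>)
    also have "\<dots> = 2*pi*(tail n)\<^sup>2" by (simp add: circle_norm2_def)
    finally show ?thesis .
  qed
  have "circle_norm2 r (\<lambda>z. w z * shifted 1 (w z)) \<le> 2*pi*B + 2*pi*(tail n)\<^sup>2" for n
  proof -
    have "2*pi*(\<Sum>k<n. (norm (c (Suc k)))\<^sup>2) \<le> 2*pi*B" using B by (intro mult_left_mono) auto
    then show ?thesis using iter[of n] bound[of n] by linarith
  qed
  moreover have "(\<lambda>n. 2*pi*B + 2*pi*(tail n)\<^sup>2) \<longlonglongrightarrow> 2*pi*B + 2*pi*0\<^sup>2"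
    by (intro tendsto_intros tail0)
  ultimately have "circle_norm2 r (\<lambda>z. w z * shifted 1 (w z)) \<le> 2*pi*B"
    by (intro LIMSEQ_le_const[of "\<lambda>n. 2*pi*B + 2*pi*(tail n)\<^sup>2" "2*pi*B"]) auto
  moreover have "circle_norm2 r (\<lambda>z. F (w z) - c 0) = circle_norm2 r (\<lambda>z. w z * shifted 1 (w z))"
    unfolding circle_norm2_def using r
    by (intro integral_cong) (simp add: norm_mult wb shifted_0[symmetric] shifted_Suc[of _ 0])
  ultimately show ?thesis by simp
qed

end

section \<open>The Poisson-type kernel of the half-plane\<close>

text \<open>One minus the squared pseudohyperbolic distance of \<open>a\<close> and \<open>w\<close>
  in the right half-plane, as \<open>half_plane_kernel_eq\<close> shows. This form is visibly
  positive and can be summed over an orbit directly.\<close>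

definition half_plane_kernel :: "complex \<Rightarrow> complex \<Rightarrow> real" where
  "half_plane_kernel a w = 4 * Re a * Re w / (norm (w + cnj a))\<^sup>2"

lemma half_plane_kernel_eq:
  assumes "Re a > 0" "Re w > 0"
  shows "half_plane_kernel a w = 1 - (norm ((w - a) / (w + cnj a)))\<^sup>2"
proof -
  have "Re (w + cnj a) > 0" using assms by simp
  then have "w + cnj a \<noteq> 0" by (metis less_irrefl zero_complex.sel(1))
  then have nz: "(norm (w + cnj a))\<^sup>2 \<noteq> 0" by simp
  have "(norm (w + cnj a))\<^sup>2 - (norm (w - a))\<^sup>2 = 4 * Re a * Re w"
    unfolding cmod_power2 by (simp add: power2_eq_square algebra_simps)
  moreover have "1 - X / Y = (Y - X) / Y" if "Y \<noteq> 0" for X Y :: real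
    using that by (simp add: diff_divide_distrib)
  ultimately show ?thesis
    using nz by (simp add: half_plane_kernel_def norm_divide power_divide)
qed

text \<open>Precede \<open>\<psi>\<close> by the disc automorphism that sends 0 to \<open>p\<close>,
  and follow it by the Cayley transform that sends \<open>\<psi> p\<close> to 0. The result
  \<open>f\<close> is a self-map of the disc fixing 0, and the claim is the Schwarz lemma for
  \<open>f\<close> rewritten with the kernel.\<close>

lemma Schwarz_Pick_half_plane:
  assumes hol: "\<psi> holomorphic_on ball 0 1" and pos: "\<And>z. norm z < 1 \<Longrightarrow> Re (\<psi> z) > 0"
    and p: "norm p < 1" and z: "norm z < 1"
  shows "1 - (norm z)\<^sup>2 \<le> half_plane_kernel (\<psi> p) (\<psi> (Moebius_function 0 (-p) z))"
proof -
  define M where "M = Moebius_function 0 (-p)"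
  define f where "f z = (\<psi> (M z) - \<psi> p) / (\<psi> (M z) + cnj (\<psi> p))" for z
  have M: "norm (M z) < 1" if "norm z < 1" for z
    using that p unfolding M_def by (intro Moebius_function_norm_lt_1) auto
  have M0: "M 0 = p" by (simp add: M_def Moebius_function_of_zero)
  have "M holomorphic_on ball 0 1" unfolding M_def using p by (intro Moebius_function_holomorphic) auto
  moreover have "M ` ball 0 1 \<subseteq> ball 0 1" using M by auto
  ultimately have hM: "(\<lambda>z. \<psi> (M z)) holomorphic_on ball 0 1"
    using holomorphic_on_compose_gen[OF _ hol, of M "ball 0 1"] by (simp add: comp_def)
  have nz: "\<psi> (M z) + cnj (\<psi> p) \<noteq> 0" if "norm z < 1" for z
  proof -
    have "Re (\<psi> (M z) + cnj (\<psi> p)) > 0" using pos[OF M[OF that]] pos[OF p] by simp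
    then show ?thesis by (metis less_irrefl zero_complex.sel(1))
  qed
  have kern: "half_plane_kernel (\<psi> p) (\<psi> (M z)) = 1 - (norm (f z))\<^sup>2" if "norm z < 1" for z
    unfolding f_def using pos[OF M[OF that]] pos[OF p] by (rule half_plane_kernel_eq[rotated])
  have "norm (f z) \<le> norm z"
  proof (rule Schwarz_Lemma(1)[OF _ _ _ z])
    show "f holomorphic_on ball 0 1" unfolding f_def by (intro holomorphic_intros hM) (use nz in auto)
    show "f 0 = 0" by (simp add: f_def M0)
    show "norm (f z) < 1" if z: "norm z < 1" for z
    proof -
      have "half_plane_kernel (\<psi> p) (\<psi> (M z)) > 0"
        using pos[OF M[OF z]] pos[OF p] nz[OF z] by (simp add: half_plane_kernel_def)
      then have "(norm (f z))\<^sup>2 < 1\<^sup>2" using kern[OF z] by simp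
      then show ?thesis by (rule power2_less_imp_less) simp
    qed
  qed
  then have "(norm (f z))\<^sup>2 \<le> (norm z)\<^sup>2" by (intro power_mono) auto
  then show ?thesis using kern[OF z] by (simp add: M_def)
qed

text \<open>Discarding imaginary parts bounds each term by 4 t / (1 + t)^2, where t is the ratio of
  the real parts. Along the orbit t is multiplied by \<open>a\<close>, and 1/(1+t) - 1/(1+a t) =
  (a-1) t / ((1+t)(1+a t)) makes the sum telescope, with a bound free of \<open>w\<close>.\<close>

lemma sum_half_plane_kernel_hyperbolic:
  fixes a :: real
  assumes a: "a > 1" and w0: "Re w0 > 0" and w: "Re w > 0"
  shows "(\<Sum>n<N. half_plane_kernel (of_real (a ^ n) * w0) w) \<le> 4 * a / (a - 1)"
proof -
  define t where "t n = a ^ n * Re w0 / Re w" for n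
  have tpos: "t n > 0" for n using a w0 w by (simp add: t_def)
  have tS: "t (Suc n) = a * t n" for n by (simp add: t_def)
  have le: "half_plane_kernel (of_real (a ^ n) * w0) w \<le> 4 * a / (a - 1) * (1 / (1 + t n) - 1 / (1 + t (Suc n)))" for n
  proof -
    have rp: "Re w + a ^ n * Re w0 > 0" using a w0 w by (simp add: add_pos_pos)
    have "(Re w + a ^ n * Re w0)\<^sup>2 \<le> (norm (w + cnj (of_real (a ^ n) * w0)))\<^sup>2"
      unfolding cmod_power2 by (simp flip: of_real_power)
    then have "half_plane_kernel (of_real (a ^ n) * w0) w \<le> 4 * (a ^ n * Re w0) * Re w / (Re w + a ^ n * Re w0)\<^sup>2"
      unfolding half_plane_kernel_def using a w0 w rp
      by (auto intro!: divide_left_mono mult_pos_pos simp flip: of_real_power)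
    also have "\<dots> = 4 * t n / (1 + t n)\<^sup>2"
      using w rp by (simp add: t_def field_simps power2_eq_square)
    also have "\<dots> = 4 * (t n / ((1 + t n) * (1 + t n)))" by (simp add: power2_eq_square)
    \<comment> \<open>One factor 1 + t is exchanged for 1 + a t to obtain the telescoping
      denominator; as 1 + a t \<le> a (1 + t), the cost is a factor \<open>a\<close>.\<close>
    also have "\<dots> \<le> 4 * (a * t n / ((1 + t n) * (1 + a * t n)))"
    proof -
      have "t n * ((1 + t n) * (1 + a * t n)) \<le> (a * t n) * ((1 + t n) * (1 + t n))"
      proof -
        have "1 + a * t n \<le> a * (1 + t n)" using a by (simp add: algebra_simps)
        then have "(t n * (1 + t n)) * (1 + a * t n) \<le> (t n * (1 + t n)) * (a * (1 + t n))"
          using tpos[of n] by (intro mult_left_mono) auto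
        then show ?thesis by (simp add: mult_ac)
      qed
      moreover have "(1 + t n) * (1 + t n) > 0" "(1 + t n) * (1 + a * t n) > 0"
        using tpos[of n] a by (auto intro!: mult_pos_pos add_pos_pos)
      ultimately show ?thesis by (simp add: frac_le_eq divide_le_eq field_simps)
    qed
    also have "\<dots> = 4 * a / (a - 1) * (1 / (1 + t n) - 1 / (1 + t (Suc n)))"
    proof -
      have "1 + t n \<noteq> 0" "1 + a * t n \<noteq> 0" "a - 1 \<noteq> 0"
        using tpos[of n] a by (auto simp: add_pos_pos intro!: less_imp_neq[symmetric])
      then show ?thesis unfolding tS by (simp add: divide_simps) (simp add: algebra_simps)
    qed
    finally show ?thesis .
  qed
  have "(\<Sum>n<N. half_plane_kernel (of_real (a ^ n) * w0) w) \<le> (\<Sum>n<N. 4 * a / (a - 1) * (1 / (1 + t n) - 1 / (1 + t (Suc n))))"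
    by (intro sum_mono le)
  also have "\<dots> = 4 * a / (a - 1) * (1 / (1 + t 0) - 1 / (1 + t N))"
    by (simp only: sum_distrib_left[symmetric] sum_lessThan_telescope'[of "\<lambda>n. 1 / (1 + t n)"])
  also have "\<dots> \<le> 4 * a / (a - 1) * 1"
    using a tpos[of 0] tpos[of N] by (intro mult_left_mono) (auto simp: field_simps add_pos_pos)
  finally show ?thesis by simp
qed

text \<open>The real part of the orbit is constant, so the terms are essentially values of the
  Cauchy density A / (A^2 + x^2) at points with spacing 1. Comparison with its integral, an arctan,
  bounds the sum independently of the scale \<open>A\<close> and the offset \<open>u\<close>, hence
  of \<open>w\<close>.\<close>

lemma sum_half_plane_kernel_parabolic:
  fixes \<sigma> :: real
  assumes \<sigma>: "\<bar>\<sigma>\<bar> = 1" and w0: "Re w0 > 0" and w: "Re w > 0"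
  shows "(\<Sum>n<N. half_plane_kernel (w0 + of_nat n * (of_real \<sigma> * \<i>)) w)
           \<le> 4 * Re w0 * (2 + 2 / (Re w0)\<^sup>2) * pi"
proof -
  define A where "A = Re w + Re w0"
  \<comment> \<open>Because the square of \<open>\<sigma>\<close> is 1, multiplying by
    \<open>\<sigma>\<close> turns both directions of translation into the single sequence n -
    u.\<close>
  define u where "u = \<sigma> * (Im w - Im w0)"
  define v where "v n = arctan ((real n - u) / A)" for n
  \<comment> \<open>For z between s and s + 1 one has z^2 \<le> 2 s^2 + 2. The additive 2 is
    absorbed by k A^2, because A is at least Re w0; this is why \<open>C\<close> depends on
    \<open>w0\<close> but not on \<open>w\<close>.\<close>
  define k where "k = 2 / (Re w0)\<^sup>2"
  define C where "C = 2 + k"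
  have A: "A > 0" "Re w \<le> A" "Re w0 \<le> A" using w w0 by (auto simp: A_def)
  have C: "C > 0" using w0 by (auto simp: C_def k_def intro!: add_pos_nonneg)
  have \<sigma>2: "\<sigma> * \<sigma> = 1" using \<sigma> by (metis abs_mult_self_eq mult_1)
  have le: "half_plane_kernel (w0 + of_nat n * (of_real \<sigma> * \<i>)) w \<le> 4 * Re w0 * C * (v (Suc n) - v n)" for n
  proof -
    define s where "s = real n - u"
    have s2: "(Im w - (Im w0 + real n * \<sigma>))\<^sup>2 = s\<^sup>2"
    proof -
      have "s = - \<sigma> * (Im w - (Im w0 + real n * \<sigma>))"
        using \<sigma>2 by (simp add: s_def u_def algebra_simps)
      then have "s\<^sup>2 = (\<sigma> * \<sigma>) * (Im w - (Im w0 + real n * \<sigma>))\<^sup>2" by (simp add: power2_eq_square mult_ac)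
      then show ?thesis using \<sigma>2 by simp
    qed
    have nn: "(norm (w + cnj (w0 + of_nat n * (of_real \<sigma> * \<i>))))\<^sup>2 = A\<^sup>2 + s\<^sup>2"
      unfolding cmod_power2 s2[symmetric] by (simp add: A_def algebra_simps)
    have As: "A\<^sup>2 + s\<^sup>2 > 0" using A by (simp add: add_pos_nonneg)
    have "half_plane_kernel (w0 + of_nat n * (of_real \<sigma> * \<i>)) w = 4 * Re w0 * (Re w / (A\<^sup>2 + s\<^sup>2))"
      unfolding half_plane_kernel_def nn by simp
    \<comment> \<open>Enlarging the numerator from Re w to \<open>A\<close> produces exactly the
      derivative of arctan (x / A).\<close>
    also have "\<dots> \<le> 4 * Re w0 * (A / (A\<^sup>2 + s\<^sup>2))"
      using A As w0 by (intro mult_left_mono divide_right_mono) auto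
    also have "A / (A\<^sup>2 + s\<^sup>2) \<le> C * (v (Suc n) - v n)"
    proof -
      have "\<exists>z. s < z \<and> z < s + 1 \<and> arctan ((s + 1) / A) - arctan (s / A) = (s + 1 - s) * (A / (A\<^sup>2 + z\<^sup>2))"
      proof (rule MVT2)
        fix x
        have "((\<lambda>x. arctan (x / A)) has_real_derivative inverse (1 + (x / A)\<^sup>2) * (1 / A)) (at x)"
          using A by (auto intro!: derivative_eq_intros)
        moreover have "inverse (1 + (x / A)\<^sup>2) * (1 / A) = A / (A\<^sup>2 + x\<^sup>2)"
          using A by (simp add: field_simps power2_eq_square add_nonneg_eq_0_iff)
        ultimately show "((\<lambda>x. arctan (x / A)) has_real_derivative A / (A\<^sup>2 + x\<^sup>2)) (at x)" by simp
      qed simp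
      then obtain z where z: "s < z" "z < s + 1" and d: "arctan ((s + 1) / A) - arctan (s / A) = A / (A\<^sup>2 + z\<^sup>2)"
        by auto
      have vd: "v (Suc n) - v n = A / (A\<^sup>2 + z\<^sup>2)" unfolding v_def d[symmetric] s_def by (simp add: algebra_simps)
      have "z\<^sup>2 \<le> 2 * s\<^sup>2 + 2"
      proof -
        have "(z - s)\<^sup>2 \<le> 1" using z by (simp add: power_le_one)
        moreover have "2 * s\<^sup>2 + 2 * (z - s)\<^sup>2 - z\<^sup>2 = (z - 2 * s)\<^sup>2" by (simp add: power2_eq_square algebra_simps)
        moreover have "(z - 2 * s)\<^sup>2 \<ge> 0" by simp
        ultimately show ?thesis by linarith
      qed
      moreover have "2 \<le> k * A\<^sup>2"
      proof -
        have "(Re w0)\<^sup>2 \<le> A\<^sup>2" using A w0 by (intro power_mono) auto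
        then show ?thesis using w0 by (simp add: k_def field_simps)
      qed
      moreover have "0 \<le> k * s\<^sup>2" "0 \<le> A\<^sup>2" by (auto simp: k_def)
      moreover have "C * (A\<^sup>2 + s\<^sup>2) = 2 * A\<^sup>2 + 2 * s\<^sup>2 + k * A\<^sup>2 + k * s\<^sup>2"
        by (simp add: C_def algebra_simps)
      ultimately have "A\<^sup>2 + z\<^sup>2 \<le> C * (A\<^sup>2 + s\<^sup>2)" by linarith
      moreover have "A\<^sup>2 + z\<^sup>2 > 0" using A by (simp add: add_pos_nonneg)
      ultimately have "1 / (A\<^sup>2 + s\<^sup>2) \<le> C / (A\<^sup>2 + z\<^sup>2)" using As by (simp add: field_simps)
      from mult_left_mono[OF this, of A] show ?thesis using A unfolding vd by (simp add: field_simps)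
    qed
    finally show ?thesis using w0 by (simp add: mult_ac)
  qed
  have "(\<Sum>n<N. half_plane_kernel (w0 + of_nat n * (of_real \<sigma> * \<i>)) w) \<le> (\<Sum>n<N. 4 * Re w0 * C * (v (Suc n) - v n))"
    by (intro sum_mono le)
  also have "\<dots> = 4 * Re w0 * C * (v N - v 0)"
    by (simp only: sum_distrib_left[symmetric] sum_lessThan_telescope)
  also have "\<dots> \<le> 4 * Re w0 * C * pi"
    using C w0 arctan_ubound[of "(real N - u) / A"] arctan_lbound[of "(0 - u) / A"]
    by (intro mult_left_mono) (auto simp: v_def)
  finally show ?thesis by (simp add: C_def k_def)
qed

section \<open>Coefficients and weighted area in logarithmic coordinates\<close>

text \<open>The exponential maps this half-strip bijectively onto the unit disc slit along the
  segment [0, 1). Horizontal lines go to radii and vertical segments to circles, so it replaces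
  polar coordinates by a holomorphic change of variables.\<close>

definition log_strip :: "complex set" where
  "log_strip = {z. Re z < 0 \<and> 0 < Im z \<and> Im z < 2 * pi}"

lemma open_log_strip [simp]: "open log_strip"
  unfolding log_strip_def
  by (intro open_Collect_conj open_Collect_less continuous_intros)

lemma inj_on_exp_log_strip: "inj_on exp log_strip"
proof (rule inj_onI)
  fix x y assume "x \<in> log_strip" "y \<in> log_strip" "exp x = exp y"
  then show "x = y"
    using exp_complex_eqI[of x y] by (auto simp: log_strip_def abs_if)
qed

lemma exp_log_strip: "z \<in> log_strip \<Longrightarrow> norm (exp z) < 1"
  by (simp add: log_strip_def)

lemma nn_integral_circle_norm2:
  assumes "continuous_on (ball 0 1) G" "0 \<le> r" "r < 1"
  shows "(\<integral>\<^sup>+t. ennreal ((norm (G (of_real r * cis t)))\<^sup>2) * indicator {0<..<2*pi} t \<partial>lborel) = ennreal (circle_norm2 r G)"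
    and "(\<integral>\<^sup>+t. ennreal ((norm (G (of_real r * cis t)))\<^sup>2) * indicator {0..2*pi} t \<partial>lborel) = ennreal (circle_norm2 r G)"
proof -
  have "((\<lambda>t. (norm (G (of_real r * cis t)))\<^sup>2) has_integral circle_norm2 r G) {0..2*pi}"
    unfolding circle_norm2_def
    by (intro integrable_integral integrable_continuous_real continuous_intros continuous_on_circle assms)
  moreover from this have "((\<lambda>t. (norm (G (of_real r * cis t)))\<^sup>2) has_integral circle_norm2 r G) {0<..<2*pi}"
    by (simp only: has_integral_Icc_iff_Ioo)
  ultimately show "(\<integral>\<^sup>+t. ennreal ((norm (G (of_real r * cis t)))\<^sup>2) * indicator {0<..<2*pi} t \<partial>lborel) = ennreal (circle_norm2 r G)"
    "(\<integral>\<^sup>+t. ennreal ((norm (G (of_real r * cis t)))\<^sup>2) * indicator {0..2*pi} t \<partial>lborel) = ennreal (circle_norm2 r G)"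
    by (intro nn_integral_has_integral_lebesgue'; simp)+
qed

lemma (in disc_power_series) deriv_power_series:
  "disc_power_series (deriv F) (\<lambda>k. of_nat (Suc k) * c (Suc k))"
proof
  fix z :: complex assume z: "norm z < 1"
  have "F holomorphic_on ball 0 1"
    by (rule power_series_holomorphic[of _ _ c]) (simp add: sums)
  then have "(F has_field_derivative deriv F z) (at z)"
    using z by (intro holomorphic_derivI[of _ "ball 0 1"]) auto
  from termdiffs_sums_strong[OF sums this z]
  show "(\<lambda>k. of_nat (Suc k) * c (Suc k) * z ^ k) sums deriv F z" by (simp add: diffs_def)
qed

text \<open>With r = exp x this is the integral of (1 - r^2) r^(2k+1) dr over (0, 1), which equals
  1/(2k+2) - 1/(2k+4).\<close>

lemma nn_integral_exp_weight:
  "(\<integral>\<^sup>+x. ennreal ((1 - exp (2*x)) * exp (2*x) * exp (x) ^ (2*k)) * indicator {..<0} x \<partial>lborel)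
     = ennreal (1 / (2 * (real k + 1) * (real k + 2)))"
proof -
  define f where "f x = (1 - exp (-2*x)) * exp (-2*x) * exp (-x) ^ (2*k)" for x :: real
  define G where "G x = exp (- ((2 * real k + 4) * x)) / (2 * real k + 4) - exp (- ((2 * real k + 2) * x)) / (2 * real k + 2)" for x :: real
  have f_eq: "f x = exp (- ((2 * real k + 2) * x)) - exp (- ((2 * real k + 4) * x))" for x
    unfolding f_def by (simp add: exp_of_nat_mult[symmetric] algebra_simps flip: exp_add)
  have "(\<integral>\<^sup>+x. ennreal ((1 - exp (2*x)) * exp (2*x) * exp x ^ (2*k)) * indicator {..<0} x \<partial>lborel)
      = (\<integral>\<^sup>+x. ennreal ((1 - exp (2*x)) * exp (2*x) * exp x ^ (2*k)) * indicator {..0} x \<partial>lborel)"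
    by (intro nn_integral_cong) (auto simp: indicator_def)
  also have "\<dots> = (\<integral>\<^sup>+x. ennreal (f x) * indicator {0..} x \<partial>lborel)"
    by (subst nn_integral_real_affine[of _ "-1" 0]) (auto simp: f_def indicator_def intro!: nn_integral_cong)
  also have "\<dots> = ennreal (0 - G 0)"
  proof (rule nn_integral_FTC_atLeast)
    show "f \<in> borel_measurable borel" unfolding f_def by measurable
    show "(G has_real_derivative f x) (at x)" for x
    proof -
      have *: "((\<lambda>x. exp (- (a * x)) / a) has_real_derivative - exp (- (a * x))) (at x)" if "a > 0" for a
        using that by (auto intro!: derivative_eq_intros)
      from DERIV_diff[OF * *, of "2 * real k + 4" "2 * real k + 2"] show ?thesis
        unfolding G_def f_eq by (simp add: add_nonneg_pos)
    qed
    show "f x \<ge> 0" if "x \<ge> 0" for x using that unfolding f_def by simp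
    have "filterlim (\<lambda>x::real. a * x) at_top at_top" if "a > 0" for a :: real
      using that by (intro filterlim_tendsto_pos_mult_at_top[OF tendsto_const _ filterlim_ident])
    then have "((\<lambda>x. exp (- (a * x)) / a) \<longlongrightarrow> 0 / a) at_top" if "a > 0" for a :: real
      using that by (intro tendsto_divide tendsto_const filterlim_compose[OF exp_at_bot]
         filterlim_uminus_at_bot_at_top[THEN filterlim_compose]) auto
    from tendsto_diff[OF this this, of "2 * real k + 4" "2 * real k + 2"]
    show "(G \<longlongrightarrow> 0) at_top" unfolding G_def by (simp add: add_nonneg_pos)
  qed
  also have "0 - G 0 = 1 / (2 * (real k + 1) * (real k + 2))"
  proof -
    have "2 * real k + 4 = 2 * (real k + 2)" "2 * real k + 2 = 2 * (real k + 1)" by auto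
    then show ?thesis unfolding G_def by (simp only: mult_zero_right minus_zero exp_zero) (simp add: divide_simps)
  qed
  finally show ?thesis .
qed

text \<open>One half of a Littlewood-Paley identity. In polar coordinates the integral of (1 -
  |z|^2) |F'|^2 gives the coefficient of index k + 1 the weight pi (k+1)/(k+2), which is at least
  pi/2; this explains the constant 2/pi. The factor |exp z|^2 in the integrand is the Jacobian of
  exp.\<close>

lemma (in disc_power_series) coefficient_sum_le_weighted_area:
  "ennreal (\<Sum>k<n. (norm (c (Suc k)))\<^sup>2)
    \<le> ennreal (2 / pi) * (\<integral>\<^sup>+z. ennreal ((1 - (norm (exp z))\<^sup>2) * (norm (deriv F (exp z) * exp z))\<^sup>2) * indicator log_strip z \<partial>lborel)"
proof -
  interpret d: disc_power_series "deriv F" "\<lambda>k. of_nat (Suc k) * c (Suc k)" by (rule deriv_power_series)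
  define h where "h z = ennreal ((1 - (norm (exp z))\<^sup>2) * (norm (deriv F (exp z) * exp z))\<^sup>2) * indicator log_strip z" for z
  have "d.shifted 0 holomorphic_on ball 0 1" by (rule d.holomorphic_shifted)
  then have holD: "deriv F holomorphic_on ball 0 1"
    by (rule holomorphic_transform) (use d.shifted_0 in auto)
  then have contD: "continuous_on (ball 0 1) (deriv F)" by (rule holomorphic_on_imp_continuous_on)
  have "continuous_on log_strip (\<lambda>z. deriv F (exp z))"
    by (rule continuous_on_compose2[OF contD]) (auto intro!: continuous_intros simp: exp_log_strip[simplified])
  then have "continuous_on log_strip (\<lambda>z. (1 - (norm (exp z))\<^sup>2) * (norm (deriv F (exp z) * exp z))\<^sup>2)"
    by (intro continuous_intros)
  then have [measurable]: "h \<in> borel_measurable borel"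
    unfolding h_def by (rule borel_measurable_ennreal_times_indicator) simp
  \<comment> \<open>For fixed \<open>x\<close> the integral over \<open>y\<close> is a circle
    integral of |F'|^2 at radius exp x, to which Bessel's inequality for the derivative
    applies.\<close>
  have inner: "(\<Sum>k<n. ennreal (2*pi*(real (Suc k))\<^sup>2 * (norm (c (Suc k)))\<^sup>2) * (ennreal ((1 - exp (2*x)) * exp (2*x) * exp x ^ (2*k)) * indicator {..<0} x))
      \<le> (\<integral>\<^sup>+y. h (Complex x y) \<partial>lborel)" for x
  proof (cases "x < 0")
    case True
    define r where "r = exp x"
    have r: "0 \<le> r" "r < 1" using True by (auto simp: r_def)
    have r2: "r\<^sup>2 \<le> 1" using r by (simp add: power_le_one)
    have e: "exp (Complex x y) = of_real r * cis y" for y by (simp add: r_def exp_eq_polar)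
    have E2: "exp (2*x) = r\<^sup>2" by (simp add: r_def exp_double)
    have "(\<Sum>k<n. ennreal (2*pi*(real (Suc k))\<^sup>2 * (norm (c (Suc k)))\<^sup>2) * (ennreal ((1 - exp (2*x)) * exp (2*x) * exp x ^ (2*k)) * indicator {..<0} x))
      = ennreal (\<Sum>k<n. 2*pi*(real (Suc k))\<^sup>2 * (norm (c (Suc k)))\<^sup>2 * ((1 - r\<^sup>2) * r\<^sup>2 * r ^ (2*k)))"
      using True r r2 unfolding E2 r_def[symmetric]
      by (subst sum_ennreal[symmetric]) (auto simp: ennreal_mult[symmetric])
    also have "(\<Sum>k<n. 2*pi*(real (Suc k))\<^sup>2 * (norm (c (Suc k)))\<^sup>2 * ((1 - r\<^sup>2) * r\<^sup>2 * r ^ (2*k)))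
       = (1 - r\<^sup>2) * r\<^sup>2 * (2*pi*(\<Sum>k<n. (norm (of_nat (Suc k) * c (Suc k)))\<^sup>2 * r ^ (2*k)))"
      by (simp add: sum_distrib_left norm_mult power_mult_distrib mult_ac del: of_nat_Suc)
    also have "\<dots> \<le> (1 - r\<^sup>2) * r\<^sup>2 * circle_norm2 r (deriv F)"
      using r2 by (intro mult_left_mono d.Bessel_inequality r) auto
    also have "ennreal \<dots> = ennreal ((1 - r\<^sup>2) * r\<^sup>2) * (\<integral>\<^sup>+y. ennreal ((norm (deriv F (of_real r * cis y)))\<^sup>2) * indicator {0<..<2*pi} y \<partial>lborel)"
      using r2 circle_norm2_nonneg by (subst nn_integral_circle_norm2(1)[OF contD r]) (simp add: ennreal_mult)
    also have "\<dots> = (\<integral>\<^sup>+y. h (Complex x y) \<partial>lborel)"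
    proof (subst nn_integral_cmult[symmetric])
      have "continuous_on {0<..<2*pi} (\<lambda>y. (norm (deriv F (of_real r * cis y)))\<^sup>2)"
        by (intro continuous_intros continuous_on_circle contD r)
      then show "(\<lambda>y. ennreal ((norm (deriv F (of_real r * cis y)))\<^sup>2) * indicator {0<..<2*pi} y) \<in> borel_measurable lborel"
        unfolding measurable_lborel2 by (rule borel_measurable_ennreal_times_indicator) simp
      show "(\<integral>\<^sup>+y. ennreal ((1 - r\<^sup>2) * r\<^sup>2) * (ennreal ((norm (deriv F (of_real r * cis y)))\<^sup>2) * indicator {0<..<2*pi} y) \<partial>lborel)
         = (\<integral>\<^sup>+y. h (Complex x y) \<partial>lborel)"
        using True r r2 by (intro nn_integral_cong)
          (auto simp: h_def e norm_mult power_mult_distrib ennreal_mult[symmetric] log_strip_def indicator_def mult_ac)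
    qed
    finally show ?thesis by (simp add: ennreal_leI)
  qed simp
  have "ennreal (pi / 2 * (\<Sum>k<n. (norm (c (Suc k)))\<^sup>2))
     \<le> ennreal (\<Sum>k<n. 2*pi*(real (Suc k))\<^sup>2 * (norm (c (Suc k)))\<^sup>2 * (1 / (2 * (real k + 1) * (real k + 2))))"
    unfolding sum_distrib_left
  proof (intro ennreal_leI sum_mono)
    fix k
    \<comment> \<open>After cancellation the right-hand side is (k+1) / (2 (k+2)), with equality at
      k = 0.\<close>
    have "1 / 4 \<le> (real (Suc k))\<^sup>2 * (1 / (2 * (real k + 1) * (real k + 2)))"
    proof -
      have *: "t\<^sup>2 * (1 / (2 * t * s)) = t / (2 * s)" if "t > 0" for s t :: real
        using that by (simp add: power2_eq_square)
      have "1 / 4 \<le> (real k + 1) / (2 * (real k + 2))" by (simp add: field_simps)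
      also have "\<dots> = (real (Suc k))\<^sup>2 * (1 / (2 * (real k + 1) * (real k + 2)))"
        using *[of "real k + 1" "real k + 2"] by (simp add: add.commute)
      finally show ?thesis .
    qed
    from mult_left_mono[OF this, of "2 * pi * (norm (c (Suc k)))\<^sup>2"]
    show "pi / 2 * (norm (c (Suc k)))\<^sup>2 \<le> 2*pi*(real (Suc k))\<^sup>2 * (norm (c (Suc k)))\<^sup>2 * (1 / (2 * (real k + 1) * (real k + 2)))"
      by (simp add: mult_ac)
  qed
  also have "\<dots> = (\<Sum>k<n. ennreal (2*pi*(real (Suc k))\<^sup>2 * (norm (c (Suc k)))\<^sup>2) * ennreal (1 / (2 * (real k + 1) * (real k + 2))))"
  proof -
    have "ennreal (\<Sum>k<n. 2*pi*(real (Suc k))\<^sup>2 * (norm (c (Suc k)))\<^sup>2 * (1 / (2 * (real k + 1) * (real k + 2))))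
      = (\<Sum>k<n. ennreal (2*pi*(real (Suc k))\<^sup>2 * (norm (c (Suc k)))\<^sup>2 * (1 / (2 * (real k + 1) * (real k + 2)))))"
      by (rule sum_ennreal[symmetric]) simp
    also have "\<dots> = (\<Sum>k<n. ennreal (2*pi*(real (Suc k))\<^sup>2 * (norm (c (Suc k)))\<^sup>2) * ennreal (1 / (2 * (real k + 1) * (real k + 2))))"
      by (intro sum.cong refl ennreal_mult) auto
    finally show ?thesis .
  qed
  also have "\<dots> = (\<integral>\<^sup>+x. (\<Sum>k<n. ennreal (2*pi*(real (Suc k))\<^sup>2 * (norm (c (Suc k)))\<^sup>2) * (ennreal ((1 - exp (2*x)) * exp (2*x) * exp x ^ (2*k)) * indicator {..<0} x)) \<partial>lborel)"
    by (subst nn_integral_sum) (simp_all add: nn_integral_cmult nn_integral_exp_weight)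
  also have "\<dots> \<le> (\<integral>\<^sup>+x. \<integral>\<^sup>+y. h (Complex x y) \<partial>lborel \<partial>lborel)"
    by (intro nn_integral_mono inner)
  also have "\<dots> = (\<integral>\<^sup>+z. h z \<partial>lborel)"
    by (rule nn_integral_lborel_Complex(2)[symmetric]) simp
  finally have "ennreal (2/pi) * ennreal (pi / 2 * (\<Sum>k<n. (norm (c (Suc k)))\<^sup>2)) \<le> ennreal (2/pi) * (\<integral>\<^sup>+z. h z \<partial>lborel)"
    by (intro mult_left_mono) auto
  then show ?thesis by (simp add: h_def ennreal_mult'[symmetric])
qed

section \<open>Summability of the mean-square deviations along the orbit\<close>

lemma funpow_holomorphic_on:
  assumes g: "g holomorphic_on S" "g ` S \<subseteq> S"
  shows "(g ^^ n) holomorphic_on S" "(g ^^ n) ` S \<subseteq> S"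
proof (induction n)
  case (Suc n)
  { case 1
    have "g \<circ> (g ^^ n) holomorphic_on S"
      using Suc g(1) by (intro holomorphic_on_compose_gen)
    then show ?case by (simp add: comp_def) }
  { case 2
    show ?case using Suc g(2) by force }
qed auto

lemma inj_on_Moebius_function:
  assumes "norm p < 1" shows "inj_on (Moebius_function 0 p) (ball 0 1)"
proof (rule inj_on_inverseI)
  show "Moebius_function 0 (-p) (Moebius_function 0 p z) = z" if "z \<in> ball 0 1" for z
    using that assms by (intro Moebius_function_compose) auto
qed

lemma weighted_area_le:
  assumes q: "q holomorphic_on ball 0 1" "inj_on q (ball 0 1)" "bounded (q ` ball 0 1)"
    and q': "\<And>z. norm z < 1 \<Longrightarrow> q' (q z) = z" "continuous_on (q ` ball 0 1) q'"
    and \<psi>: "\<psi> holomorphic_on ball 0 1" "\<And>z. norm z < 1 \<Longrightarrow> Re (\<psi> z) > 0"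
    and p: "norm p < 1"
  defines "F \<equiv> \<lambda>z. q (Moebius_function 0 (-p) z)"
  shows "(\<integral>\<^sup>+z. ennreal ((1 - (norm (exp z))\<^sup>2) * (norm (deriv F (exp z) * exp z))\<^sup>2) * indicator log_strip z \<partial>lborel)
     \<le> (\<integral>\<^sup>+y. ennreal (half_plane_kernel (\<psi> p) (\<psi> (q' y))) * indicator (q ` ball 0 1) y \<partial>lborel)"
proof -
  define M where "M = Moebius_function 0 (-p)"
  define h where "h y = ennreal (half_plane_kernel (\<psi> p) (\<psi> (q' y))) * indicator (q ` ball 0 1) y" for y
  define u where "u z = F (exp z)" for z
  have M: "norm (M z) < 1" if "norm z < 1" for z
    using that p unfolding M_def by (intro Moebius_function_norm_lt_1) auto
  have holM: "M holomorphic_on ball 0 1" unfolding M_def using p by (intro Moebius_function_holomorphic) auto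
  have Mim: "M ` ball 0 1 \<subseteq> ball 0 1" using M by auto
  have F: "F = q \<circ> M" by (auto simp: F_def M_def)
  have holF: "F holomorphic_on ball 0 1"
    unfolding F by (rule holomorphic_on_compose_gen[OF holM q(1) Mim])
  have injF: "inj_on F (ball 0 1)"
    unfolding F using inj_on_Moebius_function[of "-p"] p Mim q(2)
    by (intro comp_inj_on inj_on_subset[OF q(2)]) (auto simp: M_def)
  have expb: "exp ` log_strip \<subseteq> ball 0 1" using exp_log_strip by auto
  have holu: "u holomorphic_on log_strip"
    using holomorphic_on_compose_gen[OF _ holF expb] by (simp add: u_def[abs_def] comp_def holomorphic_on_exp)
  have inju: "inj_on u log_strip"
    using comp_inj_on[OF inj_on_exp_log_strip inj_on_subset[OF injF expb]] by (simp add: u_def[abs_def] comp_def)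
  have uim: "u ` log_strip \<subseteq> q ` ball 0 1"
    unfolding u_def F comp_def using exp_log_strip M by auto
  have du: "deriv u z = deriv F (exp z) * exp z" if "z \<in> log_strip" for z
  proof -
    have "(F has_field_derivative deriv F (exp z)) (at (exp z))"
      using exp_log_strip[OF that] holF by (intro holomorphic_derivI[of _ "ball 0 1"]) auto
    then have "((\<lambda>z. F (exp z)) has_field_derivative deriv F (exp z) * exp z) (at z)"
      by (rule DERIV_chain2) (rule DERIV_exp)
    then show ?thesis unfolding u_def[abs_def] by (rule DERIV_imp_deriv)
  qed
  have hm: "h \<in> borel_measurable borel" unfolding h_def
  proof (rule borel_measurable_ennreal_times_indicator)
    show "q ` ball 0 1 \<in> sets borel" using q(1,2) by (intro borel_open open_mapping_thm3) auto
    have "continuous_on (q ` ball 0 1) (\<lambda>y. \<psi> (q' y))"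
      by (rule continuous_on_compose2[OF holomorphic_on_imp_continuous_on[OF \<psi>(1)] q'(2)]) (use q'(1) in auto)
    moreover have "\<psi> (q' y) + cnj (\<psi> p) \<noteq> 0" if "y \<in> q ` ball 0 1" for y
    proof -
      have "Re (\<psi> (q' y) + cnj (\<psi> p)) > 0" using \<psi>(2) that q'(1) p by (auto intro!: add_pos_pos)
      then show ?thesis by (metis less_irrefl zero_complex.sel(1))
    qed
    ultimately show "continuous_on (q ` ball 0 1) (\<lambda>y. half_plane_kernel (\<psi> p) (\<psi> (q' y)))"
      unfolding half_plane_kernel_def by (intro continuous_intros) auto
  qed
  have "(\<integral>\<^sup>+z. ennreal ((1 - (norm (exp z))\<^sup>2) * (norm (deriv F (exp z) * exp z))\<^sup>2) * indicator log_strip z \<partial>lborel)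
     \<le> (\<integral>\<^sup>+z\<in>log_strip. h (u z) * ennreal ((norm (deriv u z))\<^sup>2) \<partial>lborel)"
  proof (rule nn_integral_mono)
    fix z
    show "ennreal ((1 - (norm (exp z))\<^sup>2) * (norm (deriv F (exp z) * exp z))\<^sup>2) * indicator log_strip z
       \<le> h (u z) * ennreal ((norm (deriv u z))\<^sup>2) * indicator log_strip z"
    proof (cases "z \<in> log_strip")
      case True
      have e: "norm (exp z) < 1" by (rule exp_log_strip[OF True])
      have "q' (u z) = M (exp z)" unfolding u_def F comp_def by (intro q' M e)
      then have hu: "h (u z) = ennreal (half_plane_kernel (\<psi> p) (\<psi> (M (exp z))))"
        using uim True unfolding h_def by (auto simp: indicator_def)
      have "1 - (norm (exp z))\<^sup>2 \<le> half_plane_kernel (\<psi> p) (\<psi> (M (exp z)))"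
        unfolding M_def by (rule Schwarz_Pick_half_plane[OF \<psi> p e])
      moreover have "0 \<le> 1 - (norm (exp z))\<^sup>2" using e by (simp add: power_le_one)
      ultimately have "ennreal (1 - (norm (exp z))\<^sup>2) * ennreal ((norm (deriv u z))\<^sup>2) \<le> h (u z) * ennreal ((norm (deriv u z))\<^sup>2)"
        unfolding hu by (intro mult_right_mono ennreal_leI) auto
      then show ?thesis using True \<open>0 \<le> 1 - (norm (exp z))\<^sup>2\<close> by (simp only: du[OF True]) (simp add: ennreal_mult)
    qed simp
  qed
  also have "\<dots> = (\<integral>\<^sup>+y\<in>u ` log_strip. h y \<partial>lborel)"
    using uim q(3) by (intro nn_integral_holomorphic_change_of_variables holu inju hm) (auto intro: bounded_subset)
  also have "\<dots> \<le> (\<integral>\<^sup>+y. h y \<partial>lborel)"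
    by (intro nn_integral_mono) (auto simp: indicator_def)
  finally show ?thesis unfolding h_def .
qed

text \<open>For each n, q o g^n is F o w with F = q o M, where M is the automorphism taking 0 to the
  n-th orbit point and w the Schwarz function inverse(M) o g^n. Littlewood subordination, the
  coefficient estimate and \<open>weighted_area_le\<close> bound its deviation from the value at 0
  by 4 times the kernel integral \<open>H n\<close>, where 4 = 2 pi * (2 / pi).\<close>

lemma sum_circle_norm2_orbit_le:
  assumes q: "q holomorphic_on ball 0 1" "inj_on q (ball 0 1)" "q ` ball 0 1 \<subseteq> cball 0 1"
    and \<psi>: "\<psi> holomorphic_on ball 0 1" "\<And>z. norm z < 1 \<Longrightarrow> Re (\<psi> z) > 0"
    and g: "g holomorphic_on ball 0 1" "g ` ball 0 1 \<subseteq> ball 0 1"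
    and C: "\<And>w N. Re w > 0 \<Longrightarrow> (\<Sum>n<N. half_plane_kernel (\<psi> ((g ^^ n) 0)) w) \<le> C"
    and r: "0 \<le> r" "r < 1"
  shows "(\<Sum>n<N. circle_norm2 r (\<lambda>z. q ((g ^^ n) z) - q ((g ^^ n) 0))) \<le> 4 * C * measure lborel (cball 0 1 :: complex set)"
proof -
  obtain q' where q': "q' holomorphic_on q ` ball 0 1" "\<And>z. norm z < 1 \<Longrightarrow> q' (q z) = z"
    using holomorphic_has_inverse[OF q(1) open_ball q(2)] by (metis mem_ball_0)
  have cq': "continuous_on (q ` ball 0 1) q'" using q'(1) by (rule holomorphic_on_imp_continuous_on)
  have oq: "open (q ` ball 0 1)" using q(1,2) by (intro open_mapping_thm3) auto
  define p where "p n = (g ^^ n) 0" for n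
  have p: "norm (p n) < 1" for n using funpow_holomorphic_on(2)[OF g, of n] by (simp add: p_def image_subset_iff)
  have nz: "\<psi> (q' y) + cnj (\<psi> (p n)) \<noteq> 0" if "y \<in> q ` ball 0 1" for y n
  proof -
    have "Re (\<psi> (q' y) + cnj (\<psi> (p n))) > 0" using \<psi>(2) that q'(2) p[of n] by (auto intro!: add_pos_pos)
    then show ?thesis by (metis less_irrefl zero_complex.sel(1))
  qed
  define h where "h n y = ennreal (half_plane_kernel (\<psi> (p n)) (\<psi> (q' y))) * indicator (q ` ball 0 1) y" for n y
  define H where "H n = (\<integral>\<^sup>+y. h n y \<partial>lborel)" for n
  \<comment> \<open>The empty sum, N = 0, shows that \<open>C\<close> is nonnegative.\<close>
  have C0: "C \<ge> 0" using C[of 1 0] by simp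
  have kpos: "0 \<le> half_plane_kernel (\<psi> (p n)) (\<psi> (q' y))" if "y \<in> q ` ball 0 1" for n y
    using that q'(2) \<psi>(2) p[of n] by (auto simp: half_plane_kernel_def less_imp_le)
  have hm[measurable]: "h n \<in> borel_measurable borel" for n
    unfolding h_def
  proof (rule borel_measurable_ennreal_times_indicator[OF _ borel_open[OF oq]])
    have "continuous_on (q ` ball 0 1) (\<lambda>y. \<psi> (q' y))"
      by (rule continuous_on_compose2[OF holomorphic_on_imp_continuous_on[OF \<psi>(1)] cq']) (use q'(2) in auto)
    then show "continuous_on (q ` ball 0 1) (\<lambda>y. half_plane_kernel (\<psi> (p n)) (\<psi> (q' y)))"
      unfolding half_plane_kernel_def by (intro continuous_intros) (use nz in auto)
  qed
  \<comment> \<open>The sum is taken under the integral sign, where the hypothesis on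
    \<open>C\<close> bounds it at every image point; the area is at most that of the closed unit
    disc.\<close>
  have sumH: "(\<Sum>n<N. H n) \<le> ennreal (C * measure lborel (cball 0 1 :: complex set))" for N
  proof -
    have "(\<Sum>n<N. H n) = (\<integral>\<^sup>+y. (\<Sum>n<N. h n y) \<partial>lborel)"
      unfolding H_def by (subst nn_integral_sum) auto
    also have "\<dots> \<le> (\<integral>\<^sup>+y. ennreal C * indicator (cball 0 1 :: complex set) y \<partial>lborel)"
    proof (rule nn_integral_mono)
      fix y
      show "(\<Sum>n<N. h n y) \<le> ennreal C * indicator (cball 0 1 :: complex set) y"
      proof (cases "y \<in> q ` ball 0 1")
        case True
        have "(\<Sum>n<N. h n y) = ennreal (\<Sum>n<N. half_plane_kernel (\<psi> (p n)) (\<psi> (q' y)))"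
          using True kpos[OF True] unfolding h_def by (subst sum_ennreal[symmetric]) auto
        also have "\<dots> \<le> ennreal C" unfolding p_def using True q'(2) \<psi>(2) by (intro ennreal_leI C) auto
        finally show ?thesis using True q(3) by (auto simp: indicator_def)
      qed (simp add: h_def)
    qed
    also have "\<dots> = ennreal C * emeasure lborel (cball 0 1 :: complex set)"
      by (simp add: nn_integral_cmult_indicator)
    also have "\<dots> = ennreal (C * measure lborel (cball 0 1 :: complex set))"
      using C0 emeasure_bounded_finite[OF bounded_cball, of "0::complex" 1]
      by (subst emeasure_eq_ennreal_measure) (auto simp: ennreal_mult)
    finally show ?thesis .
  qed
  have Hfin: "H n < \<infinity>" for n
  proof -
    have "H n \<le> (\<Sum>n<Suc n. H n)" by simp
    also have "\<dots> < \<infinity>" using sumH[of "Suc n"] by (simp add: order_le_less_trans del: sum.lessThan_Suc)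
    finally show ?thesis .
  qed
  have one: "circle_norm2 r (\<lambda>z. q ((g ^^ n) z) - q ((g ^^ n) 0)) \<le> 4 * enn2real (H n)" for n
  proof -
    define M where "M = Moebius_function 0 (- p n)"
    define F where "F z = q (M z)" for z
    define w where "w z = Moebius_function 0 (p n) ((g ^^ n) z)" for z
    have gn: "norm ((g ^^ n) z) < 1" if "norm z < 1" for z
      using funpow_holomorphic_on(2)[OF g, of n] that by (auto simp: image_subset_iff)
    have M: "norm (M z) < 1" if "norm z < 1" for z
      using that p[of n] unfolding M_def by (intro Moebius_function_norm_lt_1) auto
    have holM: "M holomorphic_on ball 0 1" unfolding M_def using p[of n] by (intro Moebius_function_holomorphic) auto
    have holF: "F holomorphic_on ball 0 1"
    proof -
      have "M ` ball 0 1 \<subseteq> ball 0 1" using M by auto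
      from holomorphic_on_compose_gen[OF holM q(1) this] show ?thesis by (simp add: F_def[abs_def] comp_def)
    qed
    define c where "c k = (deriv ^^ k) F 0 / fact k" for k
    interpret disc_power_series F c
      using holomorphic_power_series[OF holF] by unfold_locales (simp add: c_def)
    have w1: "norm (w z) < 1" if "norm z < 1" for z
      unfolding w_def using p gn that by (intro Moebius_function_norm_lt_1)
    have holw: "w holomorphic_on ball 0 1"
    proof -
      have "(g ^^ n) ` ball 0 1 \<subseteq> ball 0 1" by (rule funpow_holomorphic_on(2)[OF g])
      from holomorphic_on_compose_gen[OF funpow_holomorphic_on(1)[OF g] Moebius_function_holomorphic[OF p] this]
      show ?thesis by (simp add: w_def[abs_def] comp_def)
    qed
    have w0: "w 0 = 0" by (simp add: w_def p_def Moebius_function_eq_zero)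
    have wz: "norm (w z) \<le> norm z" if "norm z < 1" for z
      using Schwarz_Lemma(1)[OF holw w0 w1 that] .
    have B: "(\<Sum>k<m. (norm (c (Suc k)))\<^sup>2) \<le> 2 / pi * enn2real (H n)" for m
    proof -
      have "ennreal (\<Sum>k<m. (norm (c (Suc k)))\<^sup>2) \<le> ennreal (2 / pi) * H n"
        using coefficient_sum_le_weighted_area[of m]
      proof (rule order_trans)
        show "ennreal (2 / pi) * (\<integral>\<^sup>+z. ennreal ((1 - (norm (exp z))\<^sup>2) * (norm (deriv F (exp z) * exp z))\<^sup>2) * indicator log_strip z \<partial>lborel) \<le> ennreal (2 / pi) * H n"
          unfolding H_def h_def F_def[abs_def] M_def
          by (intro mult_left_mono weighted_area_le q(1,2) bounded_subset[OF bounded_cball q(3)] \<psi> q' cq' p) auto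
      qed
      also have "\<dots> = ennreal (2 / pi * enn2real (H n))"
      proof -
        have "H n = ennreal (enn2real (H n))" using Hfin[of n] by simp
        then show ?thesis by (metis enn2real_nonneg ennreal_mult'')
      qed
      finally show ?thesis by (subst (asm) ennreal_le_iff) auto
    qed
    have "circle_norm2 r (\<lambda>z. F (w z) - c 0) \<le> 2 * pi * (2 / pi * enn2real (H n))"
      by (rule Littlewood_subordination[OF holw wz r B])
    also have "2 * pi * (2 / pi * enn2real (H n)) = 4 * enn2real (H n)" by simp
    also have "circle_norm2 r (\<lambda>z. F (w z) - c 0) = circle_norm2 r (\<lambda>z. q ((g ^^ n) z) - q ((g ^^ n) 0))"
    proof -
      have "c 0 = q ((g ^^ n) 0)" by (simp add: c_def F_def M_def Moebius_function_of_zero p_def)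
      moreover have "F (w z) = q ((g ^^ n) z)" if "norm z < 1" for z
        unfolding F_def w_def M_def using p gn that by (subst Moebius_function_compose) auto
      ultimately show ?thesis unfolding circle_norm2_def using r by (intro integral_cong) (simp add: norm_mult)
    qed
    finally show ?thesis .
  qed
  have "(\<Sum>n<N. circle_norm2 r (\<lambda>z. q ((g ^^ n) z) - q ((g ^^ n) 0))) \<le> 4 * (\<Sum>n<N. enn2real (H n))"
    unfolding sum_distrib_left by (intro sum_mono one)
  also have "(\<Sum>n<N. enn2real (H n)) = enn2real (\<Sum>n<N. H n)"
    using Hfin by (subst enn2real_sum) auto
  also have "\<dots> \<le> C * measure lborel (cball 0 1 :: complex set)"
    using C0 sumH[of N] by (intro enn2real_leI) auto
  finally show ?thesis by (simp add: mult_ac)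
qed

section \<open>Radial boundary behaviour\<close>

text \<open>Fatou's lemma needs a sequence of radii, and limits along \<open>at_left 1\<close> can
  be evaluated on this one. The shift by 2 makes the first radius 1/2, so that all radii are
  positive.\<close>

lemma filterlim_radii: "filterlim (\<lambda>j. 1 - 1 / real (j + 2)) (at_left 1) sequentially"
  unfolding filterlim_at
proof
  have "(\<lambda>n. 1 - 1 / real (n + 2)) \<longlonglongrightarrow> 1 - 0"
    by (intro tendsto_intros LIMSEQ_ignore_initial_segment[OF lim_1_over_n])
  then show "(\<lambda>n. 1 - 1 / real (n + 2)) \<longlonglongrightarrow> 1" by simp
qed auto

lemma radii: "0 \<le> 1 - 1 / real (j + 2)" "1 - 1 / real (j + 2) < 1"
  by (auto simp: field_simps)

text \<open>The function ln B - ln |k| is nonnegative and is the real part of the holomorphic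
  function \<open>G\<close>, so its circle means are all equal to its value at 0. By Fatou its
  liminf along almost every radius is finite, whereas it would be infinite where \<open>k\<close>
  tends to 0. Existence of the radial limit is not presupposed.\<close>

lemma AE_radial_not_tendsto_0:
  assumes k: "k holomorphic_on ball 0 1" "\<And>z. norm z < 1 \<Longrightarrow> k z \<noteq> 0" "\<And>z. norm z < 1 \<Longrightarrow> norm (k z) \<le> B"
  shows "AE t in lborel. t \<in> {0..2*pi} \<longrightarrow> \<not> ((\<lambda>r. k (of_real r * cis t)) \<longlongrightarrow> 0) (at_left 1)"
proof -
  obtain L where L: "L holomorphic_on ball 0 1" "\<And>z. z \<in> ball 0 1 \<Longrightarrow> k z = exp (L z)"
    using contractible_imp_holomorphic_log[OF k(1)] k(2) by (auto simp: convex_imp_contractible)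
  have B: "B > 0" using k(2,3)[of 0] by (metis norm_zero zero_less_one zero_less_norm_iff order_less_le_trans)
  define G where "G z = of_real (ln B) - L z" for z
  have holG: "G holomorphic_on ball 0 1" unfolding G_def by (intro holomorphic_intros L)
  have contG: "continuous_on (ball 0 1) G" by (rule holomorphic_on_imp_continuous_on[OF holG])
  have ReG: "Re (G z) = ln B - ln (norm (k z))" if "norm z < 1" for z
    using L(2)[of z] that by (simp add: G_def)
  have Gpos: "Re (G z) \<ge> 0" if "norm z < 1" for z
    using ReG[OF that] k(2,3)[OF that] B by simp
  define \<rho> where "\<rho> j = 1 - 1 / real (j + 2)" for j
  have \<rho>: "0 \<le> \<rho> j" "\<rho> j < 1" for j unfolding \<rho>_def by (rule radii)+
  define u where "u j t = ennreal (Re (G (of_real (\<rho> j) * cis t))) * indicator {0..2*pi} t" for j t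
  have contu: "continuous_on {0..2*pi} (\<lambda>t. Re (G (of_real (\<rho> j) * cis t)))" for j
    by (intro continuous_intros continuous_on_circle contG \<rho>)
  have [measurable]: "u j \<in> borel_measurable borel" for j
    unfolding u_def by (rule borel_measurable_ennreal_times_indicator[OF contu]) simp
  have int: "(\<integral>\<^sup>+t. u j t \<partial>lborel) = ennreal (2 * pi * Re (G 0))" for j
  proof -
    have "((\<lambda>t. Re (G (of_real (\<rho> j) * cis t))) has_integral Re (of_real (2*pi) * G 0)) {0..2*pi}"
      by (intro has_integral_Re circle_mean_value holG \<rho>)
    then have "((\<lambda>t. Re (G (of_real (\<rho> j) * cis t))) has_integral 2 * pi * Re (G 0)) {0..2*pi}"
      by simp
    then show ?thesis unfolding u_def
      by (intro nn_integral_has_integral_lebesgue') (use Gpos \<rho> in \<open>auto simp: norm_mult\<close>)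
  qed
  have "(\<integral>\<^sup>+t. liminf (\<lambda>j. u j t) \<partial>lborel) \<le> liminf (\<lambda>j. \<integral>\<^sup>+t. u j t \<partial>lborel)"
    by (rule nn_integral_liminf) simp
  also have "\<dots> < \<infinity>" unfolding int by (simp add: Liminf_const)
  finally have "AE t in lborel. liminf (\<lambda>j. u j t) \<noteq> \<infinity>"
    by (intro nn_integral_PInf_AE) auto
  then show ?thesis
  proof (eventually_elim, intro impI notI)
    fix t assume fin: "liminf (\<lambda>j. u j t) \<noteq> \<infinity>" and t: "t \<in> {0..2*pi}"
      and lim: "((\<lambda>r. k (of_real r * cis t)) \<longlongrightarrow> 0) (at_left 1)"
    define v where "v j = norm (k (of_real (\<rho> j) * cis t))" for j
    have v: "v \<longlonglongrightarrow> 0" unfolding v_def \<rho>_def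
      using tendsto_norm[OF filterlim_compose[OF lim filterlim_radii]] by simp
    have vpos: "v j > 0" for j unfolding v_def using k(2) \<rho> by (auto simp: norm_mult)
    have "v j \<in> {0<..} \<and> v j \<noteq> 0" for j using vpos[of j] by simp
    then have "filterlim v (at_right 0) sequentially"
      using v by (simp add: filterlim_at)
    then have "filterlim (\<lambda>j. ln (v j)) at_bot sequentially"
      by (rule filterlim_compose[OF ln_at_0])
    then have "filterlim (\<lambda>j. ln B + - ln (v j)) at_top sequentially"
      by (intro filterlim_tendsto_add_at_top[OF tendsto_const] filterlim_compose[OF filterlim_uminus_at_top_at_bot])
    moreover have "ln B + - ln (v j) = Re (G (of_real (\<rho> j) * cis t))" for j
      using ReG[of "of_real (\<rho> j) * cis t"] \<rho>[of j] by (simp add: v_def norm_mult)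
    ultimately have "((\<lambda>j. ennreal (Re (G (of_real (\<rho> j) * cis t)))) \<longlongrightarrow> \<infinity>) sequentially"
      by (simp add: filterlim_compose[OF ennreal_tendsto_top_eq_at_top[THEN iffD2]] ennreal_tendsto_top_eq_at_top)
    then have "(\<lambda>j. u j t) \<longlonglongrightarrow> \<infinity>" using t by (simp add: u_def)
    then have "liminf (\<lambda>j. u j t) = \<infinity>" by (intro lim_imp_Liminf) auto
    with fin show False by simp
  qed
qed

lemma AE_orbit_radial_limits:
  fixes p :: "nat \<Rightarrow> complex"
  assumes h: "\<And>n. continuous_on (ball 0 1) (h n)"
    and B: "\<And>r N. 0 \<le> r \<Longrightarrow> r < 1 \<Longrightarrow> (\<Sum>n<N. circle_norm2 r (\<lambda>z. h n z - p n)) \<le> B"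
  shows "AE t in lborel. t \<in> {0..2*pi} \<longrightarrow>
    (\<forall>v L. (\<forall>n r. 0 < r \<and> r < 1 \<longrightarrow> 0 \<le> v n r \<and> v n r \<le> norm (h n (of_real r * cis t) - p n)) \<longrightarrow>
       (\<forall>n. (v n \<longlongrightarrow> (L n :: real)) (at_left 1)) \<longrightarrow> L \<longlonglongrightarrow> 0)"
proof -
  define \<rho> where "\<rho> j = 1 - 1 / real (j + 2)" for j
  have \<rho>: "0 \<le> \<rho> j" "\<rho> j < 1" for j unfolding \<rho>_def by (rule radii)+
  define d where "d j n t = ennreal ((norm (h n (of_real (\<rho> j) * cis t) - p n))\<^sup>2) * indicator {0..2*pi} t" for j n t
  have conth: "continuous_on (ball 0 1) (\<lambda>z. h n z - p n)" for n by (intro continuous_intros h)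
  have [measurable]: "d j n \<in> borel_measurable borel" for j n
  proof -
    have "continuous_on {0..2*pi} (\<lambda>t. (norm (h n (of_real (\<rho> j) * cis t) - p n))\<^sup>2)"
      by (intro continuous_intros continuous_on_circle[OF h] \<rho>)
    then show ?thesis unfolding d_def by (rule borel_measurable_ennreal_times_indicator) simp
  qed
  have di: "(\<integral>\<^sup>+t. d j n t \<partial>lborel) = ennreal (circle_norm2 (\<rho> j) (\<lambda>z. h n z - p n))" for j n
    unfolding d_def by (rule nn_integral_circle_norm2(2)[OF conth \<rho>])
  have S: "(\<integral>\<^sup>+t. (\<Sum>n. d j n t) \<partial>lborel) \<le> ennreal B" for j
  proof -
    have "(\<integral>\<^sup>+t. (\<Sum>n. d j n t) \<partial>lborel) = (\<Sum>n. \<integral>\<^sup>+t. d j n t \<partial>lborel)"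
      by (intro nn_integral_suminf) auto
    also have "\<dots> \<le> ennreal B"
    proof (rule suminf_le_const)
      fix N
      have "(\<Sum>n<N. \<integral>\<^sup>+t. d j n t \<partial>lborel) = ennreal (\<Sum>n<N. circle_norm2 (\<rho> j) (\<lambda>z. h n z - p n))"
        unfolding di by (intro sum_ennreal circle_norm2_nonneg)
      also have "\<dots> \<le> ennreal B" by (intro ennreal_leI B \<rho>)
      finally show "(\<Sum>n<N. \<integral>\<^sup>+t. d j n t \<partial>lborel) \<le> ennreal B" .
    qed auto
    finally show ?thesis .
  qed
  have "(\<integral>\<^sup>+t. liminf (\<lambda>j. \<Sum>n. d j n t) \<partial>lborel) \<le> liminf (\<lambda>j. \<integral>\<^sup>+t. (\<Sum>n. d j n t) \<partial>lborel)"
    by (rule nn_integral_liminf) simp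
  also have "\<dots> \<le> liminf (\<lambda>j. ennreal B)"
    by (intro Liminf_mono always_eventually allI S)
  also have "\<dots> < \<infinity>" by (simp add: Liminf_const)
  finally have "AE t in lborel. liminf (\<lambda>j. \<Sum>n. d j n t) \<noteq> \<infinity>"
    by (intro nn_integral_PInf_AE) auto
  then show ?thesis
  proof (eventually_elim, intro impI allI)
    fix t and v :: "nat \<Rightarrow> real \<Rightarrow> real" and L
    assume fin: "liminf (\<lambda>j. \<Sum>n. d j n t) \<noteq> \<infinity>" and t: "t \<in> {0..2*pi}"
      and v: "\<forall>n r. 0 < r \<and> r < 1 \<longrightarrow> 0 \<le> v n r \<and> v n r \<le> norm (h n (of_real r * cis t) - p n)"
      and lim: "\<forall>n. (v n \<longlongrightarrow> L n) (at_left 1)"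
    have \<rho>0: "0 < \<rho> j" for j by (simp add: \<rho>_def field_simps)
    have vd: "ennreal ((v n (\<rho> j))\<^sup>2) \<le> d j n t" for n j
      using v \<rho>0[of j] \<rho>(2)[of j] t by (auto simp: d_def intro!: ennreal_leI power_mono)
    have vl: "(\<lambda>j. ennreal ((v n (\<rho> j))\<^sup>2)) \<longlonglongrightarrow> ennreal ((L n)\<^sup>2)" for n
      unfolding \<rho>_def
      by (intro tendsto_ennrealI tendsto_power filterlim_compose[OF lim[rule_format] filterlim_radii])
    \<comment> \<open>Only finite sums can be passed to the limit in \<open>j\<close>; the bound is
      uniform in \<open>N\<close>, so the series follows.\<close>
    have "(\<Sum>n<N. ennreal ((L n)\<^sup>2)) \<le> liminf (\<lambda>j. \<Sum>n. d j n t)" for N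
    proof -
      have "(\<lambda>j. \<Sum>n<N. ennreal ((v n (\<rho> j))\<^sup>2)) \<longlonglongrightarrow> (\<Sum>n<N. ennreal ((L n)\<^sup>2))"
        by (intro tendsto_sum vl)
      then have "(\<Sum>n<N. ennreal ((L n)\<^sup>2)) = liminf (\<lambda>j. \<Sum>n<N. ennreal ((v n (\<rho> j))\<^sup>2))"
        by (intro lim_imp_Liminf[symmetric]) auto
      also have "\<dots> \<le> liminf (\<lambda>j. \<Sum>n. d j n t)"
      proof (intro Liminf_mono always_eventually allI)
        fix j
        have "(\<Sum>n<N. ennreal ((v n (\<rho> j))\<^sup>2)) \<le> (\<Sum>n<N. d j n t)" by (intro sum_mono vd)
        also have "\<dots> \<le> (\<Sum>n. d j n t)" by (intro sum_le_suminf) auto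
        finally show "(\<Sum>n<N. ennreal ((v n (\<rho> j))\<^sup>2)) \<le> (\<Sum>n. d j n t)" .
      qed
      finally show ?thesis .
    qed
    then have "(\<Sum>n. ennreal ((L n)\<^sup>2)) \<le> liminf (\<lambda>j. \<Sum>n. d j n t)"
      by (intro suminf_le_const) auto
    with fin have "(\<Sum>n. ennreal ((L n)\<^sup>2)) \<noteq> \<infinity>" by (auto simp: top_unique)
    then have "summable (\<lambda>n. (L n)\<^sup>2)"
      by (intro summable_suminf_not_top) auto
    from tendsto_real_sqrt[OF summable_LIMSEQ_zero[OF this]]
    show "L \<longlonglongrightarrow> 0" by (simp add: tendsto_rabs_zero_iff)
  qed
qed

text \<open>A length-area argument: the integral of |u'|^2 over the strip is the area of the image,
  hence finite, so |u'|^2 is integrable along almost every horizontal line. This makes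
  \<open>u\<close> uniformly continuous on the line up to its end x = 0, which corresponds to the
  point of the unit circle.\<close>

lemma AE_radial_limit_exists:
  assumes q: "q holomorphic_on ball 0 1" "inj_on q (ball 0 1)" "bounded (q ` ball 0 1)"
  shows "AE t in lborel. t \<in> {0<..<2*pi} \<longrightarrow> (\<exists>l. ((\<lambda>r. q (of_real r * cis t)) \<longlongrightarrow> l) (at_left 1))"
proof -
  define u where "u z = q (exp z)" for z
  have expb: "exp ` log_strip \<subseteq> ball 0 1" using exp_log_strip by auto
  have holu: "u holomorphic_on log_strip"
    using holomorphic_on_compose_gen[OF _ q(1) expb] by (simp add: u_def[abs_def] comp_def holomorphic_on_exp)
  have inju: "inj_on u log_strip"
    using comp_inj_on[OF inj_on_exp_log_strip inj_on_subset[OF q(2) expb]] by (simp add: u_def[abs_def] comp_def)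
  have uim: "u ` log_strip \<subseteq> q ` ball 0 1"
    unfolding u_def using expb by auto
  have bu: "bounded (u ` log_strip)" using uim q(3) by (rule bounded_subset[rotated])
  define h where "h z = ennreal ((norm (deriv u z))\<^sup>2) * indicator log_strip z" for z
  have cd: "continuous_on log_strip (deriv u)"
    by (intro holomorphic_on_imp_continuous_on holomorphic_deriv holu open_log_strip)
  have [measurable]: "h \<in> borel_measurable borel"
    unfolding h_def by (intro borel_measurable_ennreal_times_indicator continuous_intros cd) simp
  have "(\<integral>\<^sup>+y. \<integral>\<^sup>+x. h (Complex x y) \<partial>lborel \<partial>lborel) = (\<integral>\<^sup>+z. h z \<partial>lborel)"
    by (rule nn_integral_lborel_Complex(1)[symmetric]) simp
  also have "\<dots> = (\<integral>\<^sup>+y\<in>u ` log_strip. 1 \<partial>lborel)"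
    using nn_integral_holomorphic_change_of_variables[OF open_log_strip holu inju bu, of "\<lambda>_. 1"] by (simp add: h_def)
  also have "\<dots> = emeasure lborel (u ` log_strip)"
    using open_mapping_thm3[OF holu open_log_strip inju] by simp
  also have "\<dots> < \<infinity>" by (rule emeasure_bounded_finite[OF bu])
  finally have "AE y in lborel. (\<integral>\<^sup>+x. h (Complex x y) \<partial>lborel) \<noteq> \<infinity>"
  proof (intro nn_integral_PInf_AE)
    have "(\<lambda>(x, y). Complex x y) \<in> borel_measurable borel"
      by (intro borel_measurable_continuous_onI) (auto simp: case_prod_beta Complex_eq intro!: continuous_intros)
    then have [measurable]: "(\<lambda>(x, y). Complex x y) \<in> borel_measurable (lborel \<Otimes>\<^sub>M lborel)"
      by (simp add: lborel_prod)
    have [measurable]: "(\<lambda>p. h (Complex (snd p) (fst p))) \<in> borel_measurable (lborel \<Otimes>\<^sub>M lborel)"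
    proof -
      have "(\<lambda>p. h ((\<lambda>(x, y). Complex x y) (snd p, fst p))) \<in> borel_measurable (lborel \<Otimes>\<^sub>M lborel)"
        by measurable
      then show ?thesis by simp
    qed
    show "(\<lambda>y. \<integral>\<^sup>+x. h (Complex x y) \<partial>lborel) \<in> borel_measurable lborel"
      by measurable
  qed auto
  then show ?thesis
  proof (eventually_elim, intro impI)
    fix y assume fin: "(\<integral>\<^sup>+x. h (Complex x y) \<partial>lborel) \<noteq> \<infinity>" and y: "y \<in> {0<..<2*pi}"
    define X where "X = enn2real (\<integral>\<^sup>+x. h (Complex x y) \<partial>lborel)"
    have X0: "X \<ge> 0" by (simp add: X_def)
    have str: "Complex x y \<in> log_strip" if "x < 0" for x using y that by (auto simp: log_strip_def)
    \<comment> \<open>A substitute for the Cauchy-Schwarz inequality: d \<le> l d^2 + 1/l is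
      integrated, with the parameter \<open>l\<close> left free.\<close>
    have le: "norm (u (Complex b y) - u (Complex a y)) \<le> l * X + (b - a) / l"
      if ab: "a \<le> b" "b < 0" and l: "l > 0" for a b l
    proof -
      have der: "((\<lambda>x. u (Complex x y)) has_vector_derivative deriv u (Complex x y)) (at x within {a..b})" if "x \<in> {a..b}" for x
      proof -
        have "(u has_field_derivative deriv u (Complex x y)) (at (Complex x y))"
          using that ab by (intro holomorphic_derivI[OF holu open_log_strip] str) auto
        moreover have "((\<lambda>x. Complex x y) has_vector_derivative 1) (at x within {a..b})"
          unfolding Complex_eq by (auto intro!: derivative_eq_intros)
        ultimately have "(u \<circ> (\<lambda>x. Complex x y) has_vector_derivative 1 * deriv u (Complex x y)) (at x within {a..b})"
          by (intro field_vector_diff_chain_within) (auto intro: has_field_derivative_at_within)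
        then show ?thesis by (simp add: comp_def)
      qed
      have I: "((\<lambda>x. deriv u (Complex x y)) has_integral u (Complex b y) - u (Complex a y)) {a..b}"
        by (rule fundamental_theorem_of_calculus[OF ab(1) der])
      have cx: "continuous_on {a..b} (\<lambda>x. deriv u (Complex x y))"
        by (rule continuous_on_compose2[OF cd]) (use ab str in \<open>auto simp: Complex_eq intro!: continuous_intros\<close>)
      define J where "J = integral {a..b} (\<lambda>x. (norm (deriv u (Complex x y)))\<^sup>2)"
      have J: "((\<lambda>x. (norm (deriv u (Complex x y)))\<^sup>2) has_integral J) {a..b}"
        unfolding J_def by (intro integrable_integral integrable_continuous_real continuous_intros cx)
      have "ennreal J = (\<integral>\<^sup>+x. ennreal ((norm (deriv u (Complex x y)))\<^sup>2) * indicator {a..b} x \<partial>lborel)"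
        by (rule nn_integral_has_integral_lebesgue'[OF _ J, symmetric]) simp
      also have "\<dots> \<le> (\<integral>\<^sup>+x. h (Complex x y) \<partial>lborel)"
        using ab str by (intro nn_integral_mono) (auto simp: h_def indicator_def)
      also have "\<dots> = ennreal X" using fin by (simp add: X_def top.not_eq_extremum)
      finally have JX: "J \<le> X" using X0 by (simp add: ennreal_le_iff)
      have "norm (u (Complex b y) - u (Complex a y)) \<le> l * J + (1 / l) * (b - a)"
      proof -
        have B: "((\<lambda>x. l * (norm (deriv u (Complex x y)))\<^sup>2 + 1 / l) has_integral l * J + (1 / l) * (b - a)) {a..b}"
          using has_integral_const_real[of "1 / l" a b] ab
          by (intro has_integral_add has_integral_mult_right J) (simp add: mult.commute)
        have "norm (integral {a..b} (\<lambda>x. deriv u (Complex x y))) \<le> integral {a..b} (\<lambda>x. l * (norm (deriv u (Complex x y)))\<^sup>2 + 1 / l)"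
        proof (rule integral_norm_bound_integral)
          fix x
          let ?d = "norm (deriv u (Complex x y))"
          \<comment> \<open>With d for \<open>?d\<close>, both sides equal l^2 d^2 - l d +
            1.\<close>
          have "0 \<le> (l * ?d - 1)\<^sup>2 + l * ?d" using l by (simp add: add_nonneg_nonneg)
          also have "\<dots> = l * (l * ?d\<^sup>2 + 1 / l - ?d)" using l by (simp add: field_simps power2_eq_square)
          finally show "?d \<le> l * ?d\<^sup>2 + 1 / l" using l by (simp add: zero_le_mult_iff)
        qed (use I B in auto)
        then show ?thesis using I B by (simp add: integral_unique)
      qed
      also have "\<dots> \<le> l * X + (b - a) / l" using JX l by simp
      finally show ?thesis .
    qed
    have "uniformly_continuous_on {..<0} (\<lambda>x. u (Complex x y))"
      unfolding uniformly_continuous_on_def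
    proof (intro allI impI)
      fix e :: real assume e: "e > 0"
      \<comment> \<open>This choice keeps l X below e/2, the summand 1 in the denominator covering X
        = 0; points closer than l e / 2 then contribute less than another e/2.\<close>
      define l where "l = e / (2 * (X + 1))"
      have l: "l > 0" using e X0 by (simp add: l_def)
      have lX: "l * X < e / 2" using e X0 by (simp add: l_def field_simps)
      have main: "norm (u (Complex b y) - u (Complex a y)) < e" if "a \<le> b" "b < 0" "b - a < l * e / 2" for a b
      proof -
        have "(b - a) / l < e / 2" using that(3) l by (simp add: field_simps)
        then show ?thesis using le[OF that(1,2) l] lX by linarith
      qed
      show "\<exists>d>0. \<forall>x\<in>{..<0}. \<forall>x'\<in>{..<0}. dist x' x < d \<longrightarrow> dist (u (Complex x' y)) (u (Complex x y)) < e"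
      proof (intro exI[of _ "l * e / 2"] conjI ballI impI)
        show "0 < l * e / 2" using l e by simp
        fix a b :: real assume ab: "a \<in> {..<0}" "b \<in> {..<0}" "dist b a < l * e / 2"
        show "dist (u (Complex b y)) (u (Complex a y)) < e"
          using main[of a b] main[of b a] ab
          by (cases "a \<le> b") (auto simp: dist_norm norm_minus_commute)
      qed
    qed
    moreover have "(0::real) \<in> closure {..<0}" by simp
    ultimately obtain l where l: "((\<lambda>x. u (Complex x y)) \<longlongrightarrow> l) (at 0 within {..<0})"
      by (rule uniformly_continuous_on_extension_at_closure)
    have "((\<lambda>r. ln r) \<longlongrightarrow> ln 1) (at_left (1::real))"
      by (intro tendsto_intros) auto
    moreover have "eventually (\<lambda>r::real. r \<in> {0<..<1}) (at_left 1)"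
      by (intro eventually_at_left_real) simp
    ultimately have "filterlim (\<lambda>r::real. ln r) (at 0 within {..<0}) (at_left 1)"
      unfolding filterlim_at by (auto elim!: eventually_mono)
    from filterlim_compose[OF l this]
    have "((\<lambda>r. u (Complex (ln r) y)) \<longlongrightarrow> l) (at_left 1)" .
    moreover have "eventually (\<lambda>r. u (Complex (ln r) y) = q (of_real r * cis y)) (at_left 1)"
      using eventually_at_left_real[of 0 "1::real"]
      by (auto elim!: eventually_mono simp: u_def exp_eq_polar)
    ultimately have "((\<lambda>r. q (of_real r * cis y)) \<longlongrightarrow> l) (at_left 1)"
      by (rule Lim_transform_eventually)
    then show "\<exists>l. ((\<lambda>r. q (of_real r * cis y)) \<longlongrightarrow> l) (at_left 1)" by blast
  qed
qed

section \<open>Omitted values, poles and escape on the boundary\<close>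

lemma countable_poles:
  assumes "f meromorphic_on UNIV" shows "countable {z. is_pole f z}"
proof -
  have "{z. is_pole f z} sparse_in UNIV"
    using assms by (meson UNIV_I meromorphic_on_isolated_singularity meromorphic_on_meromorphic_at not_islimpt_poles open_UNIV sparse_in_open)
  then show ?thesis using sparse_imp_countable[of UNIV "{z. is_pole f z}"] by simp
qed

text \<open>Koebe's square-root trick. If s y = - s z, then phi y = phi z, so y = z by injectivity
  and s z = 0, contradicting that \<open>c\<close> is omitted. Hence -s z avoids the disc around s 0
  that the open mapping theorem places inside the image, which keeps s z + s 0 away from 0.\<close>

lemma univalent_sqrt:
  assumes \<phi>: "\<phi> holomorphic_on ball 0 1" "inj_on \<phi> (ball 0 1)" and c: "c \<notin> \<phi> ` ball 0 1"
  obtains s \<epsilon> where "s holomorphic_on ball 0 1" "\<And>z. norm z < 1 \<Longrightarrow> (s z)\<^sup>2 = \<phi> z - c"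
    "\<epsilon> > 0" "\<And>z. norm z < 1 \<Longrightarrow> \<epsilon> \<le> norm (s z + s 0)" "inj_on s (ball 0 1)"
proof -
  have hol: "(\<lambda>z. \<phi> z - c) holomorphic_on ball 0 1" by (intro holomorphic_intros \<phi>)
  have nz: "\<phi> z - c \<noteq> 0" if "z \<in> ball 0 1" for z using c that by auto
  obtain s where s: "s holomorphic_on ball 0 1" "\<And>z. z \<in> ball 0 1 \<Longrightarrow> \<phi> z - c = (s z)\<^sup>2"
    using contractible_imp_holomorphic_sqrt[OF hol _ nz] by (auto simp: convex_imp_contractible)
  have inj: "inj_on s (ball 0 1)"
  proof (rule inj_onI)
    fix x y assume xy: "x \<in> ball 0 1" "y \<in> ball 0 1" "s x = s y"
    then have "\<phi> x - c = \<phi> y - c" by (simp only: s(2))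
    then have "\<phi> x = \<phi> y" by simp
    then show "x = y" using \<phi>(2) xy by (simp add: inj_on_def)
  qed
  have "open (s ` ball 0 1)" by (intro open_mapping_thm3 s inj) auto
  then obtain \<epsilon> where \<epsilon>: "\<epsilon> > 0" "ball (s 0) \<epsilon> \<subseteq> s ` ball 0 1"
    by (metis centre_in_ball image_eqI open_contains_ball zero_less_one)
  have "\<epsilon> \<le> norm (s z + s 0)" if z: "norm z < 1" for z
  proof (rule ccontr)
    assume "\<not> \<epsilon> \<le> norm (s z + s 0)"
    then have "- s z \<in> ball (s 0) \<epsilon>" by (simp add: dist_norm add.commute)
    then obtain y where y: "y \<in> ball 0 1" "s y = - s z" using \<epsilon>(2) by (metis image_iff subsetD)
    then have "\<phi> y - c = \<phi> z - c" using s(2)[of y] s(2)[of z] z by simp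
    then have "\<phi> y = \<phi> z" by simp
    then have "y = z" using \<phi>(2) y z by (simp add: inj_on_def)
    then have "s z = 0" using y by simp
    then show False using nz[of z] s(2)[of z] z by simp
  qed
  with s inj \<epsilon> show ?thesis by (intro that[of s \<epsilon>]) auto
qed

text \<open>The function phi o k - b is zero-free but may be unbounded. The quotient s / (s + s 0) =
  1 - s 0 / (s + s 0), composed with \<open>k\<close>, is zero-free and bounded, and it tends to 0
  wherever phi o k tends to \<open>b\<close>; so \<open>AE_radial_not_tendsto_0\<close> applies to
  it.\<close>

lemma AE_radial_not_tendsto_omitted_value:
  assumes \<phi>: "\<phi> holomorphic_on ball 0 1" "inj_on \<phi> (ball 0 1)" and b: "b \<notin> \<phi> ` ball 0 1"
    and k: "k holomorphic_on ball 0 1" "k ` ball 0 1 \<subseteq> ball 0 1"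
  shows "AE t in lborel. t \<in> {0..2*pi} \<longrightarrow> \<not> ((\<lambda>r. \<phi> (k (of_real r * cis t))) \<longlongrightarrow> b) (at_left 1)"
proof -
  obtain s \<epsilon> where s: "s holomorphic_on ball 0 1" "\<And>z. norm z < 1 \<Longrightarrow> (s z)\<^sup>2 = \<phi> z - b"
    "\<epsilon> > 0" "\<And>z. norm z < 1 \<Longrightarrow> \<epsilon> \<le> norm (s z + s 0)" "inj_on s (ball 0 1)"
    by (rule univalent_sqrt[OF \<phi> b]) blast
  have kn: "norm (k z) < 1" if "norm z < 1" for z using k(2) that by (auto simp: image_subset_iff)
  have nz: "s z + s 0 \<noteq> 0" if "norm z < 1" for z using s(3) s(4)[OF that] by auto
  have snz: "s z \<noteq> 0" if "norm z < 1" for z using s(2)[OF that] b that by auto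
  have "(\<lambda>z. s (k z)) holomorphic_on ball 0 1"
    using holomorphic_on_compose_gen[OF k(1) s(1) k(2)] by (simp add: comp_def)
  then have hol: "(\<lambda>z. s (k z) / (s (k z) + s 0)) holomorphic_on ball 0 1"
    by (intro holomorphic_intros) (use nz kn in auto)
  have nz2: "s (k z) / (s (k z) + s 0) \<noteq> 0" if "norm z < 1" for z
    using snz[OF kn[OF that]] nz[OF kn[OF that]] by simp
  have bound: "norm (s (k z) / (s (k z) + s 0)) \<le> 1 + norm (s 0) / \<epsilon>" if "norm z < 1" for z
  proof -
    have "s (k z) / (s (k z) + s 0) = 1 - s 0 / (s (k z) + s 0)"
      using nz[OF kn[OF that]] by (simp add: field_simps)
    also have "norm \<dots> \<le> 1 + norm (s 0) / norm (s (k z) + s 0)"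
      by (rule order_trans[OF norm_triangle_ineq4]) (simp add: norm_divide)
    also have "\<dots> \<le> 1 + norm (s 0) / \<epsilon>"
      using s(3) s(4)[OF kn[OF that]] by (intro add_left_mono divide_left_mono) (auto intro!: mult_pos_pos)
    finally show ?thesis .
  qed
  have "AE t in lborel. t \<in> {0..2*pi} \<longrightarrow> \<not> ((\<lambda>r. s (k (of_real r * cis t)) / (s (k (of_real r * cis t)) + s 0)) \<longlongrightarrow> 0) (at_left 1)"
    by (rule AE_radial_not_tendsto_0[OF hol nz2 bound])
  then show ?thesis
  proof (eventually_elim, intro impI notI)
    fix t assume nl: "t \<in> {0..2*pi} \<longrightarrow> \<not> ((\<lambda>r. s (k (of_real r * cis t)) / (s (k (of_real r * cis t)) + s 0)) \<longlongrightarrow> 0) (at_left 1)"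
      and t: "t \<in> {0..2*pi}" and lim: "((\<lambda>r. \<phi> (k (of_real r * cis t))) \<longlongrightarrow> b) (at_left 1)"
    have ev: "eventually (\<lambda>r::real. r \<in> {0<..<1}) (at_left 1)" by (intro eventually_at_left_real) simp
    have "((\<lambda>r. \<phi> (k (of_real r * cis t)) - b) \<longlongrightarrow> b - b) (at_left 1)" by (intro tendsto_intros lim)
    moreover have "eventually (\<lambda>r. \<phi> (k (of_real r * cis t)) - b = (s (k (of_real r * cis t)))\<^sup>2) (at_left 1)"
      using ev by eventually_elim (use s(2) kn in \<open>auto simp: norm_mult\<close>)
    ultimately have "((\<lambda>r. (s (k (of_real r * cis t)))\<^sup>2) \<longlongrightarrow> 0) (at_left 1)"
      by (simp add: Lim_transform_eventually)
    then have "((\<lambda>r. norm ((s (k (of_real r * cis t)))\<^sup>2)) \<longlongrightarrow> 0) (at_left 1)"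
      by (rule tendsto_norm_zero)
    then have "((\<lambda>r. sqrt ((norm (s (k (of_real r * cis t))))\<^sup>2)) \<longlongrightarrow> sqrt 0) (at_left 1)"
      by (intro tendsto_real_sqrt) (simp add: norm_power)
    then have "((\<lambda>r. norm (s (k (of_real r * cis t)))) \<longlongrightarrow> 0) (at_left 1)" by simp
    then have sl: "((\<lambda>r. s (k (of_real r * cis t))) \<longlongrightarrow> 0) (at_left 1)" by (rule tendsto_norm_zero_cancel)
    have "s 0 \<noteq> 0" using snz[of 0] by simp
    then have "((\<lambda>r. s (k (of_real r * cis t)) / (s (k (of_real r * cis t)) + s 0)) \<longlongrightarrow> 0 / (0 + s 0)) (at_left 1)"
      by (intro tendsto_intros sl) simp
    with nl t show False by simp
  qed
qed

text \<open>Four exceptional null sets are removed: where q has no radial limit, where that limit is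
  0 (so that phi would tend to infinity), where some phi o g^n tends to a pole, and where the
  summability argument fails. Elsewhere phi has a finite radial limit w whose whole orbit can be
  followed.\<close>

lemma AE_radial_limit_in_escaping_set:
  assumes mero: "f nicely_meromorphic_on UNIV"
    and \<phi>: "\<phi> holomorphic_on ball 0 1" "inj_on \<phi> (ball 0 1)"
    and nopole: "\<And>z. norm z < 1 \<Longrightarrow> \<not> is_pole f (\<phi> z)"
    and g: "g holomorphic_on ball 0 1" "g ` ball 0 1 \<subseteq> ball 0 1"
    and conj: "\<And>z. norm z < 1 \<Longrightarrow> \<phi> (g z) = f (\<phi> z)"
    and c: "c \<notin> \<phi> ` ball 0 1"
    and \<psi>: "\<psi> holomorphic_on ball 0 1" "\<And>z. norm z < 1 \<Longrightarrow> Re (\<psi> z) > 0"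
    and C: "\<And>w N. Re w > 0 \<Longrightarrow> (\<Sum>n<N. half_plane_kernel (\<psi> ((g ^^ n) 0)) w) \<le> C"
    and esc: "filterlim (\<lambda>n. (f ^^ n) (\<phi> 0)) at_infinity sequentially"
  shows "AE t in lborel. t \<in> {0<..<2*pi} \<longrightarrow>
     (\<exists>w\<in>escaping_set f. ((\<lambda>r. \<phi> (of_real r * cis t)) \<longlongrightarrow> w) (at_left 1))"
proof -
  obtain s \<epsilon> where s: "s holomorphic_on ball 0 1" "\<And>z. norm z < 1 \<Longrightarrow> (s z)\<^sup>2 = \<phi> z - c"
    "\<epsilon> > 0" "\<And>z. norm z < 1 \<Longrightarrow> \<epsilon> \<le> norm (s z + s 0)" "inj_on s (ball 0 1)"
    by (rule univalent_sqrt[OF \<phi> c]) blast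
  define q where "q z = of_real \<epsilon> / (s z + s 0)" for z
  have nz: "s z + s 0 \<noteq> 0" if "norm z < 1" for z using s(3) s(4)[OF that] by auto
  have holq: "q holomorphic_on ball 0 1"
    unfolding q_def by (intro holomorphic_intros s) (use nz in auto)
  have injq: "inj_on q (ball 0 1)"
  proof (rule inj_onI)
    fix x y assume xy: "x \<in> ball 0 1" "y \<in> ball 0 1" "q x = q y"
    then have "s x = s y" using s(3) nz[of x] nz[of y] by (simp add: q_def field_simps)
    then show "x = y" using s(5) xy by (simp add: inj_on_def)
  qed
  have nq: "norm (q z) = \<epsilon> / norm (s z + s 0)" for z using s(3) by (simp add: q_def norm_divide)
  have q1: "norm (q z) \<le> 1" if "norm z < 1" for z using s(3) s(4)[OF that] unfolding nq by (simp add: divide_le_eq)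
  have qball: "q ` ball 0 1 \<subseteq> cball 0 1" using q1 by auto
  have q0: "q z \<noteq> 0" if "norm z < 1" for z using nz[OF that] s(3) by (simp add: q_def)
  have gn: "norm ((g ^^ n) z) < 1" if "norm z < 1" for n z
    using funpow_holomorphic_on(2)[OF g, of n] that by (auto simp: image_subset_iff)
  have fn: "(f ^^ n) (\<phi> z) = \<phi> ((g ^^ n) z)" if "norm z < 1" for n z
    by (induction n) (use conj[OF gn[OF that]] in auto)
  have norm_s: "norm (s z) = sqrt (norm (\<phi> z - c))" if "norm z < 1" for z
    by (simp add: s(2)[OF that, symmetric] norm_power)
  define P where "P = {z. is_pole f z}"
  have cP: "countable P" unfolding P_def
    using mero by (intro countable_poles) (simp add: nicely_meromorphic_on_def)
  have A1: "AE t in lborel. t \<in> {0<..<2*pi} \<longrightarrow> (\<exists>l. ((\<lambda>r. q (of_real r * cis t)) \<longlongrightarrow> l) (at_left 1))"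
    by (intro AE_radial_limit_exists holq injq bounded_subset[OF bounded_cball qball])
  have A2: "AE t in lborel. t \<in> {0..2*pi} \<longrightarrow> \<not> ((\<lambda>r. q (of_real r * cis t)) \<longlongrightarrow> 0) (at_left 1)"
    by (rule AE_radial_not_tendsto_0[OF holq q0 q1])
  \<comment> \<open>Poles are omitted by phi, and there are only countably many pairs of an iterate
    and a pole.\<close>
  have A3: "AE t in lborel. \<forall>n. \<forall>b\<in>P. t \<in> {0..2*pi} \<longrightarrow> \<not> ((\<lambda>r. \<phi> ((g ^^ n) (of_real r * cis t))) \<longlongrightarrow> b) (at_left 1)"
    unfolding AE_all_countable using cP
  proof (intro allI AE_ball_countable')
    fix n b assume "b \<in> P"
    then have "b \<notin> \<phi> ` ball 0 1" using nopole by (auto simp: P_def)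
    then show "AE t in lborel. t \<in> {0..2*pi} \<longrightarrow> \<not> ((\<lambda>r. \<phi> ((g ^^ n) (of_real r * cis t))) \<longlongrightarrow> b) (at_left 1)"
      by (intro AE_radial_not_tendsto_omitted_value \<phi> funpow_holomorphic_on g)
  qed auto
  define h where "h n z = q ((g ^^ n) z)" for n z
  define p where "p n = q ((g ^^ n) 0)" for n
  have A4: "AE t in lborel. t \<in> {0..2*pi} \<longrightarrow>
    (\<forall>v L. (\<forall>n r. 0 < r \<and> r < 1 \<longrightarrow> 0 \<le> v n r \<and> v n r \<le> norm (h n (of_real r * cis t) - p n)) \<longrightarrow>
       (\<forall>n. (v n \<longlongrightarrow> (L n :: real)) (at_left 1)) \<longrightarrow> L \<longlonglongrightarrow> 0)"
  proof (rule AE_orbit_radial_limits)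
    show "continuous_on (ball 0 1) (h n)" for n
      using holomorphic_on_compose_gen[OF funpow_holomorphic_on(1)[OF g] holq funpow_holomorphic_on(2)[OF g], of n]
      unfolding h_def by (intro holomorphic_on_imp_continuous_on) (simp add: comp_def)
    show "(\<Sum>n<N. circle_norm2 r (\<lambda>z. h n z - p n)) \<le> 4 * C * measure lborel (cball 0 1 :: complex set)"
      if "0 \<le> r" "r < 1" for r N
      unfolding h_def p_def by (rule sum_circle_norm2_orbit_le[OF holq injq qball \<psi> g C that])
  qed
  have p0: "p \<longlonglongrightarrow> 0"
  proof -
    have "filterlim (\<lambda>n. \<phi> ((g ^^ n) 0)) at_infinity sequentially"
      using esc by (simp add: fn)
    then have "filterlim (\<lambda>n. \<phi> ((g ^^ n) 0) - c) at_infinity sequentially"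
      using tendsto_add_filterlim_at_infinity'[OF _ tendsto_const, of _ _ "- c"] by simp
    then have "filterlim (\<lambda>n. sqrt (norm (\<phi> ((g ^^ n) 0) - c))) at_top sequentially"
      by (intro filterlim_compose[OF sqrt_at_top] filterlim_at_infinity_imp_norm_at_top)
    then have "filterlim (\<lambda>n. norm (s ((g ^^ n) 0))) at_top sequentially"
      by (simp add: norm_s gn)
    then have "filterlim (\<lambda>n. s ((g ^^ n) 0)) at_infinity sequentially"
      by (rule filterlim_norm_at_top_imp_at_infinity)
    then have "filterlim (\<lambda>n. s ((g ^^ n) 0) + s 0) at_infinity sequentially"
      by (rule tendsto_add_filterlim_at_infinity'[OF _ tendsto_const])
    then show ?thesis unfolding p_def q_def by (rule tendsto_divide_0[OF tendsto_const])
  qed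
  have s0: "s 0 \<noteq> 0" using s(2)[of 0] c by auto
  have ev: "eventually (\<lambda>r::real. r \<in> {0<..<1}) (at_left 1)" by (intro eventually_at_left_real) simp
  from A1 A2 A3 A4 show ?thesis
  proof (eventually_elim, intro impI)
    fix t
    assume a1: "t \<in> {0<..<2*pi} \<longrightarrow> (\<exists>l. ((\<lambda>r. q (of_real r * cis t)) \<longlongrightarrow> l) (at_left 1))"
      and a2: "t \<in> {0..2*pi} \<longrightarrow> \<not> ((\<lambda>r. q (of_real r * cis t)) \<longlongrightarrow> 0) (at_left 1)"
      and a3: "\<forall>n. \<forall>b\<in>P. t \<in> {0..2*pi} \<longrightarrow> \<not> ((\<lambda>r. \<phi> ((g ^^ n) (of_real r * cis t))) \<longlongrightarrow> b) (at_left 1)"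
      and a4: "t \<in> {0..2*pi} \<longrightarrow>
        (\<forall>v L. (\<forall>n r. 0 < r \<and> r < 1 \<longrightarrow> 0 \<le> v n r \<and> v n r \<le> norm (h n (of_real r * cis t) - p n)) \<longrightarrow>
        (\<forall>n. (v n \<longlongrightarrow> (L n :: real)) (at_left 1)) \<longrightarrow> L \<longlonglongrightarrow> 0)"
      and t: "t \<in> {0<..<2*pi}"
    have t': "t \<in> {0..2*pi}" using t by auto
    have rn: "norm (of_real r * cis t) < 1" if "r \<in> {0<..<1}" for r using that by (simp add: norm_mult)
    obtain l where l: "((\<lambda>r. q (of_real r * cis t)) \<longlongrightarrow> l) (at_left 1)" using a1 t by blast
    have l0: "l \<noteq> 0" using a2 t' l by auto
    \<comment> \<open>Solving q = eps / (s + s 0) for s, and then s^2 = phi - c for phi.\<close>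
    define w where "w = c + (of_real \<epsilon> / l - s 0)\<^sup>2"
    have "((\<lambda>r. c + (of_real \<epsilon> / q (of_real r * cis t) - s 0)\<^sup>2) \<longlongrightarrow> w) (at_left 1)"
      unfolding w_def by (intro tendsto_intros l l0)
    moreover have "eventually (\<lambda>r. c + (of_real \<epsilon> / q (of_real r * cis t) - s 0)\<^sup>2 = \<phi> (of_real r * cis t)) (at_left 1)"
      using ev
    proof eventually_elim
      case (elim r)
      then show ?case using s(2)[OF rn] s(3) nz[OF rn] by (simp add: q_def)
    qed
    ultimately have w: "((\<lambda>r. \<phi> (of_real r * cis t)) \<longlongrightarrow> w) (at_left 1)"
      by (rule Lim_transform_eventually)
    \<comment> \<open>By \<open>A3\<close> the limit at stage n is not a pole, so \<open>f\<close>
      is continuous there and the semiconjugacy yields stage n + 1.\<close>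
    have wn: "((\<lambda>r. \<phi> ((g ^^ n) (of_real r * cis t))) \<longlongrightarrow> (f ^^ n) w) (at_left 1)" for n
    proof (induction n)
      case (Suc n)
      then have "\<not> is_pole f ((f ^^ n) w)" using a3 t' by (auto simp: P_def)
      then have "f analytic_on {(f ^^ n) w}" using nicely_meromorphic_on_imp_analytic_at[OF mero] by simp
      then have "isCont f ((f ^^ n) w)" by (rule analytic_at_imp_isCont)
      from isCont_tendsto_compose[OF this Suc]
      have "((\<lambda>r. f (\<phi> ((g ^^ n) (of_real r * cis t)))) \<longlongrightarrow> (f ^^ Suc n) w) (at_left 1)" by simp
      moreover have "eventually (\<lambda>r. f (\<phi> ((g ^^ n) (of_real r * cis t))) = \<phi> ((g ^^ Suc n) (of_real r * cis t))) (at_left 1)"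
        using ev by eventually_elim (simp add: conj gn rn)
      ultimately show ?case by (rule Lim_transform_eventually)
    qed (use w in simp)
    have "iterates_defined f w"
      unfolding iterates_defined_def using wn a3 t' by (auto simp: P_def)
    moreover have "filterlim (\<lambda>n. (f ^^ n) w) at_infinity sequentially"
    proof -
      \<comment> \<open>A lower bound for |q| expressed through |phi - c| alone. Unlike q o g^n,
        whose value involves a choice of square root, it has a radial limit by \<open>wn\<close>.
        Taking the maximum with 0 makes \<open>v\<close> an admissible nonnegative minorant.\<close>
      define m where "m n = \<epsilon> / (sqrt (norm ((f ^^ n) w - c)) + norm (s 0))" for n
      define v where "v n r = max 0 (\<epsilon> / (sqrt (norm (\<phi> ((g ^^ n) (of_real r * cis t)) - c)) + norm (s 0)) - norm (p n))" for n r
      have mpos: "m n > 0" for n using s(3) s0 by (simp add: m_def add_nonneg_pos)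
      have "(\<lambda>n. max 0 (m n - norm (p n))) \<longlonglongrightarrow> 0"
      proof (rule a4[rule_format, OF t', of v])
        fix n r assume r: "0 < (r::real) \<and> r < 1"
        let ?z = "(g ^^ n) (of_real r * cis t)"
        have z: "norm ?z < 1" using r by (intro gn rn) auto
        have "\<epsilon> / (norm (s ?z) + norm (s 0)) \<le> norm (h n (of_real r * cis t))"
          unfolding h_def nq using s(3) nz[OF z] by (intro divide_left_mono norm_triangle_ineq mult_pos_pos) (auto simp: s0 add_nonneg_pos)
        then have "\<epsilon> / (norm (s ?z) + norm (s 0)) - norm (p n) \<le> norm (h n (of_real r * cis t) - p n)"
          using norm_triangle_ineq2[of "h n (of_real r * cis t)" "p n"] by linarith
        then show "0 \<le> v n r \<and> v n r \<le> norm (h n (of_real r * cis t) - p n)"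
          by (simp add: v_def norm_s[OF z])
      next
        fix n
        have "sqrt (norm ((f ^^ n) w - c)) + norm (s 0) \<noteq> 0" using s0 by (simp add: add_nonneg_eq_0_iff)
        then show "(v n \<longlongrightarrow> max 0 (m n - norm (p n))) (at_left 1)"
          unfolding v_def m_def by (intro tendsto_intros wn)
      qed
      from tendsto_add[OF this tendsto_norm[OF p0]]
      have "(\<lambda>n. max 0 (m n - norm (p n)) + norm (p n)) \<longlonglongrightarrow> 0" by simp
      \<comment> \<open>Both summands of the majorant tend to 0, the second because the interior
        orbit escapes. A null sequence \<open>m n\<close> means that the orbit of w tends to
        infinity.\<close>
      then have "m \<longlonglongrightarrow> 0"
      proof (rule tendsto_sandwich[OF _ _ tendsto_const, rotated 2])
        show "\<forall>\<^sub>F n in sequentially. 0 \<le> m n" using mpos by (simp add: less_imp_le)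
        show "\<forall>\<^sub>F n in sequentially. m n \<le> max 0 (m n - norm (p n)) + norm (p n)"
          by (intro always_eventually allI) (simp add: max_def)
      qed
      then have "filterlim (\<lambda>n. inverse (m n)) at_top sequentially"
        using mpos by (intro filterlim_inverse_at_top) auto
      then have "filterlim (\<lambda>n. - norm (s 0) + \<epsilon> * inverse (m n)) at_top sequentially"
        using s(3) by (intro filterlim_tendsto_add_at_top[OF tendsto_const] filterlim_tendsto_pos_mult_at_top[OF tendsto_const])
      moreover have "- norm (s 0) + \<epsilon> * inverse (m n) = sqrt (norm ((f ^^ n) w - c))" for n
        using s(3) s0 by (simp add: m_def)
      ultimately have "filterlim (\<lambda>n. sqrt (norm ((f ^^ n) w - c))) at_top sequentially" by simp
      then have "filterlim (\<lambda>n. sqrt (norm ((f ^^ n) w - c)) * sqrt (norm ((f ^^ n) w - c))) at_top sequentially"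
        by (rule filterlim_at_top_mult_at_top) fact
      then have "filterlim (\<lambda>n. norm ((f ^^ n) w - c)) at_top sequentially" by simp
      then have "filterlim (\<lambda>n. (f ^^ n) w - c) at_infinity sequentially"
        by (rule filterlim_norm_at_top_imp_at_infinity)
      from tendsto_add_filterlim_at_infinity'[OF this tendsto_const, of c] show ?thesis by simp
    qed
    ultimately have "w \<in> escaping_set f" by (simp add: escaping_set_def)
    with w show "\<exists>w\<in>escaping_set f. ((\<lambda>r. \<phi> (of_real r * cis t)) \<longlongrightarrow> w) (at_left 1)" by blast
  qed
qed

section \<open>Measurability and transfer to harmonic measure\<close>

lemma borel_measurable_nicely_meromorphic:
  assumes "f nicely_meromorphic_on UNIV"
  shows "f \<in> borel_measurable borel"
proof -
  define P where "P = {z. is_pole f z}"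
  have cP: "countable P"
    unfolding P_def using assms by (intro countable_poles) (simp add: nicely_meromorphic_on_def)
  then have [measurable]: "P \<in> sets borel" by (rule sets.countable[rotated]) auto
  have "isCont f z" if "z \<in> - P" for z
    using nicely_meromorphic_on_imp_analytic_at[OF assms, of z] that by (auto simp: P_def intro: analytic_at_imp_isCont)
  then have "continuous_on (- P) f" by (intro continuous_at_imp_continuous_on) auto
  then have "(\<lambda>z. indicator (- P) z *\<^sub>R f z) \<in> borel_measurable borel"
    by (intro borel_measurable_continuous_on_indicator) auto
  then show ?thesis
    by (rule measurable_discrete_difference[OF _ cP]) auto
qed

lemma sets_borel_escaping_set:
  assumes "f nicely_meromorphic_on UNIV"
  shows "escaping_set f \<in> sets borel"
proof -
  have [measurable]: "f \<in> borel_measurable borel" by (rule borel_measurable_nicely_meromorphic[OF assms])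
  have [measurable]: "(f ^^ n) \<in> borel_measurable borel" for n
    by (induction n) (simp_all add: comp_def)
  have "countable {z. is_pole f z}"
    using assms by (intro countable_poles) (simp add: nicely_meromorphic_on_def)
  then have [measurable]: "{z. is_pole f z} \<in> sets borel" by (rule sets.countable[rotated]) auto
  \<comment> \<open>Natural-number bounds \<open>B\<close> make every quantifier countable, so that
    Borel measurability follows from that of the iterates.\<close>
  have "escaping_set f = {z \<in> space borel. (\<forall>n. (f ^^ n) z \<notin> {z. is_pole f z}) \<and>
     (\<forall>B::nat. \<exists>N. \<forall>n\<ge>N. real B \<le> norm ((f ^^ n) z))}"
  proof -
    have "filterlim (\<lambda>n. (f ^^ n) z) at_infinity sequentially \<longleftrightarrow> (\<forall>B::nat. \<exists>N. \<forall>n\<ge>N. real B \<le> norm ((f ^^ n) z))" for z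
    proof
      assume "filterlim (\<lambda>n. (f ^^ n) z) at_infinity sequentially"
      then have "filterlim (\<lambda>n. norm ((f ^^ n) z)) at_top sequentially"
        by (rule filterlim_at_infinity_imp_norm_at_top)
      then show "\<forall>B::nat. \<exists>N. \<forall>n\<ge>N. real B \<le> norm ((f ^^ n) z)"
        by (auto simp: filterlim_at_top eventually_sequentially)
    next
      assume *: "\<forall>B::nat. \<exists>N. \<forall>n\<ge>N. real B \<le> norm ((f ^^ n) z)"
      have "filterlim (\<lambda>n. norm ((f ^^ n) z)) at_top sequentially"
        unfolding filterlim_at_top eventually_sequentially
      proof
        fix Z :: real
        obtain N where "\<forall>n\<ge>N. real (nat \<lceil>Z\<rceil>) \<le> norm ((f ^^ n) z)" using * by blast
        then show "\<exists>N. \<forall>n\<ge>N. Z \<le> norm ((f ^^ n) z)" by (meson order_trans real_nat_ceiling_ge)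
      qed
      then show "filterlim (\<lambda>n. (f ^^ n) z) at_infinity sequentially"
        by (rule filterlim_norm_at_top_imp_at_infinity)
    qed
    then show ?thesis by (auto simp: escaping_set_def iterates_defined_def)
  qed
  also have "\<dots> \<in> sets borel" by measurable
  finally show ?thesis .
qed

text \<open>Wherever the radial limit exists it is the value of \<open>radial_limit\<close>, so the
  default value can occur on a null set only. The endpoints 0 and 2 pi, absent from the open strip,
  are two further null points. That \<open>E\<close> is Borel permits passing through the two image
  measures.\<close>

lemma AE_harmonic_measure:
  assumes \<phi>: "riemann_map \<phi> U" and E: "E \<in> sets borel"
    and AE: "AE t in lborel. t \<in> {0<..<2*pi} \<longrightarrow> (\<exists>w\<in>E. ((\<lambda>r. \<phi> (of_real r * cis t)) \<longlongrightarrow> w) (at_left 1))"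
  shows "AE w in harmonic_measure \<phi>. w \<in> E"
proof -
  have rl: "radial_limit \<phi> \<in> borel_measurable circle_measure"
    using \<phi> by (intro measurable_radial_limit holomorphic_on_imp_continuous_on) (simp add: riemann_map_def)
  have cm: "cis \<in> uniform_measure lborel {0..2*pi} \<rightarrow>\<^sub>M restrict_space borel (sphere 0 1)"
  proof (rule measurable_restrict_space2)
    have "cis \<in> borel_measurable borel"
      by (intro borel_measurable_continuous_onI continuous_intros)
    then show "cis \<in> borel_measurable (uniform_measure lborel {0..2*pi})"
      by (simp cong: measurable_cong_sets)
  qed auto
  have "AE t in lborel. t \<in> {0..2*pi} \<longrightarrow> radial_limit \<phi> (cis t) \<in> E"
    using AE AE_lborel_singleton[of 0] AE_lborel_singleton[of "2*pi"]
  proof eventually_elim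
    case (elim t)
    show ?case
    proof
      assume "t \<in> {0..2*pi}"
      with elim obtain w where w: "w \<in> E" "((\<lambda>r. \<phi> (of_real r * cis t)) \<longlongrightarrow> w) (at_left 1)" by auto
      have "radial_limit \<phi> (cis t) = w" unfolding radial_limit_def
        by (rule tendsto_Lim[OF _ w(2)]) simp
      with w show "radial_limit \<phi> (cis t) \<in> E" by simp
    qed
  qed
  then have "AE t in uniform_measure lborel {0..2*pi}. radial_limit \<phi> (cis t) \<in> E"
    by (intro AE_uniform_measureI) auto
  moreover have "{z \<in> space (restrict_space borel (sphere 0 1)). radial_limit \<phi> z \<in> E} \<in> sets (restrict_space borel (sphere 0 1))"
    using measurable_sets[OF rl E] by (simp add: circle_measure_def vimage_def Int_def conj_commute)
  ultimately have "AE z in circle_measure. radial_limit \<phi> z \<in> E"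
    unfolding circle_measure_def using cm by (subst AE_distr_iff)
  then show ?thesis
    unfolding harmonic_measure_def using rl E by (subst AE_distr_iff) auto
qed

section \<open>Riemann maps, the half-plane model and the conclusion\<close>

lemma riemann_map_inverse:
  assumes "riemann_map \<phi> U"
  shows "open U" "inv_into (ball 0 1) \<phi> holomorphic_on U" "inv_into (ball 0 1) \<phi> ` U \<subseteq> ball 0 1"
    "\<And>w. w \<in> U \<Longrightarrow> \<phi> (inv_into (ball 0 1) \<phi> w) = w"
    "\<And>z. norm z < 1 \<Longrightarrow> inv_into (ball 0 1) \<phi> (\<phi> z) = z"
proof -
  have hol: "\<phi> holomorphic_on ball 0 1" and inj: "inj_on \<phi> (ball 0 1)" and im: "\<phi> ` ball 0 1 = U"
    using assms by (auto simp: riemann_map_def bij_betw_def)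
  show "open U" using open_mapping_thm3[OF hol open_ball inj] im by simp
  show 1: "inv_into (ball 0 1) \<phi> (\<phi> z) = z" if "norm z < 1" for z
    using inj that by (intro inv_into_f_f) auto
  show "\<phi> (inv_into (ball 0 1) \<phi> w) = w" if "w \<in> U" for w
    using that im by (intro f_inv_into_f) auto
  show "inv_into (ball 0 1) \<phi> ` U \<subseteq> ball 0 1"
    unfolding im[symmetric] by (intro image_subsetI inv_into_into)
  obtain k where k: "k holomorphic_on \<phi> ` ball 0 1" "\<And>z. z \<in> ball 0 1 \<Longrightarrow> k (\<phi> z) = z"
    by (rule holomorphic_has_inverse[OF hol open_ball inj]) blast
  show "inv_into (ball 0 1) \<phi> holomorphic_on U"
  proof (rule holomorphic_transform)
    show "k holomorphic_on U" using k(1) im by simp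
    fix w assume "w \<in> U"
    then obtain z where "z \<in> ball 0 1" "w = \<phi> z" using im by blast
    then show "k w = inv_into (ball 0 1) \<phi> w" using k(2)[of z] 1[of z] by simp
  qed
qed

text \<open>The type is witnessed by some Riemann map \<open>\<phi>0\<close>, while harmonic measure
  is to be handled for every Riemann map \<open>\<phi>\<close>. Composing the Cowen map with the
  conformal change from \<open>\<phi>\<close> to \<open>\<phi>0\<close> transports the semiconjugacy
  with the same \<open>T\<close>.\<close>

lemma half_plane_semiconjugacy:
  assumes "hyperbolic_type_on f U \<or> simply_parabolic_type_on f U"
    and "f ` U \<subseteq> U" and \<phi>: "riemann_map \<phi> U"
  obtains \<psi> C where "\<psi> holomorphic_on ball 0 1" "\<And>z. norm z < 1 \<Longrightarrow> Re (\<psi> z) > 0"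
    "\<And>w N. Re w > 0 \<Longrightarrow> (\<Sum>n<N. half_plane_kernel (\<psi> ((associated_inner_function \<phi> f ^^ n) 0)) w) \<le> C"
proof -
  define g where "g = associated_inner_function \<phi> f"
  obtain \<phi>0 V \<psi>0 T where \<phi>0: "riemann_map \<phi>0 U"
    and cow: "Cowen_model (associated_inner_function \<phi>0 f) V {w. Re w > 0} \<psi>0 T"
    and T: "(\<exists>a>1. T = (\<lambda>w. of_real a * w)) \<or> (\<exists>\<sigma>. \<bar>\<sigma>\<bar> = 1 \<and> T = (\<lambda>w. w + of_real \<sigma> * \<i>))"
  proof -
    consider "hyperbolic_type_on f U" | "simply_parabolic_type_on f U" using assms(1) by blast
    then show thesis
    proof cases
      case 1
      then show thesis unfolding hyperbolic_type_on_def hyperbolic_type_def by (blast intro: that)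
    next
      case 2
      then obtain \<phi>0 V \<psi>0 where *: "riemann_map \<phi>0 U"
        "Cowen_model (associated_inner_function \<phi>0 f) V {w. Re w > 0} \<psi>0 (\<lambda>w. w + \<i>) \<or>
         Cowen_model (associated_inner_function \<phi>0 f) V {w. Re w > 0} \<psi>0 (\<lambda>w. w - \<i>)"
        unfolding simply_parabolic_type_on_def simply_parabolic_type_def by blast
      have "(\<lambda>w. w + \<i>) = (\<lambda>w. w + of_real 1 * \<i>)" "(\<lambda>w. w - \<i>) = (\<lambda>w. w + of_real (-1) * \<i>)" by auto
      then show thesis using * that[of \<phi>0 V \<psi>0] by (metis abs_minus_cancel abs_one)
    qed
  qed
  define \<theta> where "\<theta> = inv_into (ball 0 1) \<phi>0"
  define \<psi> where "\<psi> z = \<psi>0 (\<theta> (\<phi> z))" for z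
  note i = riemann_map_inverse[OF \<phi>] and i0 = riemann_map_inverse[OF \<phi>0, folded \<theta>_def]
  have \<psi>0: "\<psi>0 holomorphic_on ball 0 1" "\<And>z. norm z < 1 \<Longrightarrow> Re (\<psi>0 z) > 0"
    "\<And>z. norm z < 1 \<Longrightarrow> \<psi>0 (\<theta> (f (\<phi>0 z))) = T (\<psi>0 z)"
    using cow by (auto simp: Cowen_model_def associated_inner_function_def \<theta>_def image_subset_iff)
  have \<phi>U: "\<phi> z \<in> U" if "norm z < 1" for z using \<phi> that by (auto simp: riemann_map_def bij_betw_def)
  have th: "norm (\<theta> w) < 1" if "w \<in> U" for w using i0(3) that by (auto simp: image_subset_iff)
  have hol: "\<psi> holomorphic_on ball 0 1"
  proof -
    have "\<phi> holomorphic_on ball 0 1" "\<phi> ` ball 0 1 \<subseteq> U" using \<phi> \<phi>U by (auto simp: riemann_map_def)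
    from holomorphic_on_compose_gen[OF this(1) i0(2) this(2)]
    have "\<theta> \<circ> \<phi> holomorphic_on ball 0 1" .
    from holomorphic_on_compose_gen[OF this \<psi>0(1)] show ?thesis
      using th \<phi>U by (simp add: \<psi>_def[abs_def] comp_def image_subset_iff)
  qed
  have pos: "Re (\<psi> z) > 0" if "norm z < 1" for z
    unfolding \<psi>_def by (intro \<psi>0 th \<phi>U that)
  have fU: "f w \<in> U" if "w \<in> U" for w using assms(2) that by auto
  have gb: "norm (g z) < 1" if "norm z < 1" for z
    using i(3) fU[OF \<phi>U[OF that]] by (auto simp: g_def associated_inner_function_def image_subset_iff)
  have \<phi>g: "\<phi> (g z) = f (\<phi> z)" if "norm z < 1" for z
    using i(4)[OF fU[OF \<phi>U[OF that]]] by (simp add: g_def associated_inner_function_def)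
  have \<psi>g: "\<psi> (g z) = T (\<psi> z)" if "norm z < 1" for z
    using \<psi>0(3)[OF th[OF \<phi>U[OF that]]] i0(4)[OF \<phi>U[OF that]] by (simp add: \<psi>_def \<phi>g[OF that])
  have gn: "norm ((g ^^ n) 0) < 1" for n by (induction n) (auto intro: gb)
  have T0: "Re (\<psi> 0) > 0" by (rule pos) simp
  \<comment> \<open>The semiconjugacy turns the orbit of 0 under \<open>g\<close> into the orbit of
    \<open>\<psi> 0\<close> under the explicit map \<open>T\<close>, to which one of the two kernel
    sums applies.\<close>
  from T have "\<exists>C. \<forall>w N. Re w > 0 \<longrightarrow> (\<Sum>n<N. half_plane_kernel (\<psi> ((g ^^ n) 0)) w) \<le> C"
  proof
    assume "\<exists>a>1. T = (\<lambda>w. of_real a * w)"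
    then obtain a :: real where a: "a > 1" "T = (\<lambda>w. of_real a * w)" by blast
    have "\<psi> ((g ^^ n) 0) = of_real (a ^ n) * \<psi> 0" for n
      by (induction n) (use \<psi>g[OF gn] a in auto)
    then show ?thesis using sum_half_plane_kernel_hyperbolic[OF a(1) T0] by auto
  next
    assume "\<exists>\<sigma>. \<bar>\<sigma>\<bar> = 1 \<and> T = (\<lambda>w. w + of_real \<sigma> * \<i>)"
    then obtain \<sigma> :: real where s: "\<bar>\<sigma>\<bar> = 1" "T = (\<lambda>w. w + of_real \<sigma> * \<i>)" by blast
    have "\<psi> ((g ^^ n) 0) = \<psi> 0 + of_nat n * (of_real \<sigma> * \<i>)" for n
      by (induction n) (use \<psi>g[OF gn] s in \<open>auto simp: algebra_simps\<close>)
    then show ?thesis using sum_half_plane_kernel_parabolic[OF s(1) T0] by auto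
  qed
  then show ?thesis using that[OF hol pos] unfolding g_def by blast
qed

theorem escaping_full_harmonic_measure:
  assumes mero: "f nicely_meromorphic_on UNIV" and Baker: "invariant_Baker_domain f U"
    and type: "hyperbolic_type_on f U \<or> simply_parabolic_type_on f U"
  shows "full_harmonic_measure U (escaping_set f \<inter> frontier U)"
  unfolding full_harmonic_measure_def
proof (intro allI impI)
  fix \<phi> assume \<phi>: "riemann_map \<phi> U"
  show "frontier U - (escaping_set f \<inter> frontier U) \<in> null_sets (completion (harmonic_measure \<phi>))"
  \<comment> \<open>The whole plane has empty frontier; otherwise a point outside U provides the
    centre \<open>c\<close> of the square root.\<close>
  proof (cases "U = UNIV")
    case False
    then obtain c where c: "c \<notin> U" by blast
    have fU: "f ` U \<subseteq> U" and UF: "U \<subseteq> fatou_set f"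
      using Baker by (auto simp: invariant_Baker_domain_def in_components_subset)
    have nopole: "\<not> is_pole f z" if "z \<in> U" for z
    proof -
      have "iterates_defined f z" using UF that by (auto simp: fatou_set_def)
      then show ?thesis unfolding iterates_defined_def by (metis funpow_0)
    qed
    obtain \<psi> C where \<psi>: "\<psi> holomorphic_on ball 0 1" "\<And>z. norm z < 1 \<Longrightarrow> Re (\<psi> z) > 0"
      "\<And>w N. Re w > 0 \<Longrightarrow> (\<Sum>n<N. half_plane_kernel (\<psi> ((associated_inner_function \<phi> f ^^ n) 0)) w) \<le> C"
      using half_plane_semiconjugacy[OF type fU \<phi>] by blast
    define g where "g = associated_inner_function \<phi> f"
    note i = riemann_map_inverse[OF \<phi>]
    have hol: "\<phi> holomorphic_on ball 0 1" and inj: "inj_on \<phi> (ball 0 1)" and im: "\<phi> ` ball 0 1 = U"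
      using \<phi> by (auto simp: riemann_map_def bij_betw_def)
    have \<phi>U: "\<phi> z \<in> U" if "norm z < 1" for z using im that by auto
    have fU': "f (\<phi> z) \<in> U" if "norm z < 1" for z using \<phi>U[OF that] fU by auto
    have "f analytic_on U"
      by (subst analytic_on_analytic_at) (use nicely_meromorphic_on_imp_analytic_at[OF mero] nopole in auto)
    then have holf: "f holomorphic_on U" by (rule analytic_imp_holomorphic)
    have "AE t in lborel. t \<in> {0<..<2*pi} \<longrightarrow> (\<exists>w\<in>escaping_set f. ((\<lambda>r. \<phi> (of_real r * cis t)) \<longlongrightarrow> w) (at_left 1))"
    proof (rule AE_radial_limit_in_escaping_set[OF mero hol inj _ _ _ _ _ \<psi>(1,2)])
      show "\<not> is_pole f (\<phi> z)" if "norm z < 1" for z by (intro nopole \<phi>U that)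
      have "\<phi> ` ball 0 1 \<subseteq> U" using im by simp
      from holomorphic_on_compose_gen[OF hol holf this]
      have "f \<circ> \<phi> holomorphic_on ball 0 1" .
      moreover have "(f \<circ> \<phi>) ` ball 0 1 \<subseteq> U" using fU' by auto
      ultimately show "g holomorphic_on ball 0 1"
        using holomorphic_on_compose_gen[OF _ i(2)] by (auto simp: g_def associated_inner_function_def comp_assoc)
      show "g ` ball 0 1 \<subseteq> ball 0 1"
        using i(3) fU' by (auto simp: g_def associated_inner_function_def image_subset_iff)
      show "\<phi> (g z) = f (\<phi> z)" if "norm z < 1" for z
        using i(4)[OF fU'[OF that]] by (simp add: g_def associated_inner_function_def)
      show "c \<notin> \<phi> ` ball 0 1" using c im by simp
      show "(\<Sum>n<N. half_plane_kernel (\<psi> ((g ^^ n) 0)) w) \<le> C" if "Re w > 0" for w N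
        unfolding g_def by (rule \<psi>(3)[OF that])
      have "\<forall>\<^sub>F n in sequentially. norm ((f ^^ n) (\<phi> 0)) > B" for B
      proof -
        have "compact {\<phi> 0}" "{\<phi> 0} \<subseteq> U" using \<phi>U by auto
        then have "\<forall>\<^sub>F n in sequentially. \<forall>z\<in>{\<phi> 0}. norm ((f ^^ n) z) > B"
          using Baker unfolding invariant_Baker_domain_def by blast
        then show ?thesis by simp
      qed
      then have "filterlim (\<lambda>n. norm ((f ^^ n) (\<phi> 0))) at_top sequentially"
        unfolding filterlim_at_top_dense by blast
      then show "filterlim (\<lambda>n. (f ^^ n) (\<phi> 0)) at_infinity sequentially"
        by (rule filterlim_norm_at_top_imp_at_infinity)
    qed
    from AE_harmonic_measure[OF \<phi> sets_borel_escaping_set[OF mero] this]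
    have "AE w in harmonic_measure \<phi>. w \<in> escaping_set f" .
    moreover have sp: "space (harmonic_measure \<phi>) = UNIV" "sets (harmonic_measure \<phi>) = sets borel"
      by (auto simp: harmonic_measure_def)
    ultimately have "- escaping_set f \<in> null_sets (harmonic_measure \<phi>)"
      using sets_borel_escaping_set[OF mero] by (subst AE_iff_null_sets) auto
    then have "- escaping_set f \<in> null_sets (completion (harmonic_measure \<phi>))"
      by (rule null_sets_completionI)
    then show ?thesis by (rule null_sets_completion_subset[rotated]) auto
  qed simp
qed

theorem theoremA:
  fixes f :: "complex \<Rightarrow> complex" and U :: "complex set"
  assumes "f nicely_meromorphic_on UNIV"
    and "map_degree f UNIV > 1"
    and "invariant_Baker_domain f U"
    and "simply_connected U"
    and "hyperbolic_type_on f U \<or> simply_parabolic_type_on f U"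
  shows "(map_degree f U < \<infinity> \<longrightarrow>
            full_harmonic_measure U (escaping_set f \<inter> frontier U)) \<and>
         ((\<exists>\<phi> p. riemann_map \<phi> U \<and>
                 Denjoy_Wolff_point (associated_inner_function \<phi> f) p \<and>
                 nonsingular_at (associated_inner_function \<phi> f) p) \<longrightarrow>
            full_harmonic_measure U (escaping_set f \<inter> frontier U))"
  using escaping_full_harmonic_measure[OF assms(1,3,5)] by blast

end
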